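(* Let $p>2$, $\frac1p+\frac1q=1$, $2<\alpha\le 3$, $\eta\in(0,1)$. Let $f\in C([0,1]\times[0,\infty),[0,\infty))$ with $f(t,0)\not\equiv 0$ on $[0,1]$, and let $a\in C([0,1],[0,\infty))$ with $a(t)\not\equiv0$ on any subinterval of $[0,1]$. Assume that there exist constants $\mu>0$ and $0<\sigma<\frac{2}{2-q}$ such that $$a(t)f(t,u)\ge\mu\sigma t^{\sigma-1}\quad\text{for any }(t,u)\in(0,1]\times[0,\infty),$$ and $$|f(t,u)-f(t,v)|\le k|u-v|\quad\text{for any }t\in[0,1]\text{ and }u,v\in[0,\infty),$$ where $$0<k<\frac{\big(\sigma(q-2)+\alpha\big)\Gamma(\alpha-1)}{(q-1)\mu^{q-2}\big(\sigma(q-2)+\alpha+1\big)\mathfrak B\big(\alpha-1,\sigma(q-2)+1\big)}\Big(\int_0^1a(\tau)\,d\tau\Big)^{-1}.$$ Then the boundary value problem $$\big(\varphi_p(D^\alpha u(t))\big)'+a(t)f(t,u(t))=0,\quad t\in(0,1),$$ $$D^\alpha u(0)=u'(0)=u''(0)=0,\qquad u(1)+u'(1)=u'(\eta),$$ has a unique solution.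
   Context: $\mathfrak B(x,y)=\int_0^1t^{x-1}(1-t)^{y-1}dt$ ($x>0$, $y>0$) is the Euler beta function and $\Gamma$ is the gamma function. $\varphi_p(s)=|s|^{p-2}s$ is the $p$-Laplacian operator, and $\varphi_q=\varphi_p^{-1}$ with $\frac1p+\frac1q=1$. $D^\alpha$ is the standard Caputo derivative of order $\alpha$: for an at least $n$-times continuously differentiable function $g$, $D^\alpha g(t)=\frac{1}{\Gamma(n-\alpha)}\int_0^t\frac{g^{(n)}(s)}{(t-s)^{\alpha+1-n}}\,ds$, $n-1<\alpha<n$, $n=[\alpha]+1$, where $[\alpha]$ is the integer part of $\alpha$. *)

theory Defs
  imports "HOL-Analysis.Analysis"
begin

definition p_laplacian :: "real \<Rightarrow> real \<Rightarrow> real" where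
  "p_laplacian p s = \<bar>s\<bar> powr (p - 2) * s"

text \<open>
  The functions live on \<open>[0,1]\<close>: derivatives are taken relative to \<open>[0,1]\<close>, hence one-sided at
  the end points, and values outside \<open>[0,1]\<close> play no role.
\<close>

definition nderiv :: "nat \<Rightarrow> (real \<Rightarrow> real) \<Rightarrow> real \<Rightarrow> real" where
  "nderiv n g = ((\<lambda>h t. vector_derivative h (at t within {0..1})) ^^ n) g"

definition C_diff_on :: "nat \<Rightarrow> (real \<Rightarrow> real) \<Rightarrow> real set \<Rightarrow> bool" where
  "C_diff_on n g S \<longleftrightarrow>
     (\<forall>j<n. \<forall>t\<in>S. nderiv j g differentiable (at t within {0..1})) \<and> continuous_on S (nderiv n g)"

definition caputo_integrand :: "real \<Rightarrow> (real \<Rightarrow> real) \<Rightarrow> real \<Rightarrow> real \<Rightarrow> real" where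
  "caputo_integrand \<alpha> g t s =
     (let n = nat \<lfloor>\<alpha>\<rfloor> + 1 in nderiv n g s / (t - s) powr (\<alpha> + 1 - real n))"

text \<open>
  The integral formula is for non-integer orders (\<open>n - 1 < \<alpha> < n\<close>); at an integer order the
  Caputo derivative is, by the usual convention, the ordinary derivative of that order.
\<close>

definition caputo :: "real \<Rightarrow> (real \<Rightarrow> real) \<Rightarrow> real \<Rightarrow> real" where
  "caputo \<alpha> g t =
     (if \<alpha> \<in> \<int> then nderiv (nat \<lfloor>\<alpha>\<rfloor>) g t
      else (let n = nat \<lfloor>\<alpha>\<rfloor> + 1 in
              1 / Gamma (real n - \<alpha>) * integral {0..t} (caputo_integrand \<alpha> g t)))"

text \<open>
  When the function \<open>caputo \<alpha> g\<close> is meaningful on \<open>[0,1]\<close>. For non-integer \<open>\<alpha>\<close> the top derivative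
  \<open>g\<^sup>(\<^sup>n\<^sup>)\<close> need only exist (continuously) on \<open>(0,1]\<close>: the solutions of the problem below
  typically have \<open>g\<^sup>(\<^sup>n\<^sup>)\<close> unbounded, but integrable, at \<open>0\<close>.
\<close>

definition caputo_differentiable :: "real \<Rightarrow> (real \<Rightarrow> real) \<Rightarrow> bool" where
  "caputo_differentiable \<alpha> g \<longleftrightarrow>
     (if \<alpha> \<in> \<int> then C_diff_on (nat \<lfloor>\<alpha>\<rfloor>) g {0..1}
      else C_diff_on (nat \<lfloor>\<alpha>\<rfloor>) g {0..1} \<and> C_diff_on (nat \<lfloor>\<alpha>\<rfloor> + 1) g {0<..1} \<and>
           (\<forall>t\<in>{0..1}. caputo_integrand \<alpha> g t absolutely_integrable_on {0..t}))"

text \<open>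
  Continuity of \<open>caputo \<alpha> u\<close> on \<open>[0,1]\<close> is part of the notion of solution. It is what gives the
  condition \<open>caputo \<alpha> u 0 = 0\<close> its content: for non-integer \<open>\<alpha>\<close> the defining integral at \<open>t = 0\<close>
  ranges over a single point, so the bare value is always \<open>0\<close>. Nonnegativity of \<open>u\<close> is needed for
  \<open>f t (u t)\<close> to make sense, as \<open>f\<close> is only given on \<open>[0,1] \<times> [0,\<infinity>)\<close>.
\<close>

definition is_bvp_solution ::
  "real \<Rightarrow> real \<Rightarrow> real \<Rightarrow> (real \<Rightarrow> real) \<Rightarrow> (real \<Rightarrow> real \<Rightarrow> real) \<Rightarrow> (real \<Rightarrow> real) \<Rightarrow> bool" where
  "is_bvp_solution p \<alpha> \<eta> a f u \<longleftrightarrow>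
     (\<forall>t\<in>{0..1}. u t \<ge> 0) \<and>
     caputo_differentiable \<alpha> u \<and>
     continuous_on {0..1} (caputo \<alpha> u) \<and>
     (\<forall>t\<in>{0<..<1}. (\<lambda>s. p_laplacian p (caputo \<alpha> u s)) differentiable (at t) \<and>
        deriv (\<lambda>s. p_laplacian p (caputo \<alpha> u s)) t + a t * f t (u t) = 0) \<and>
     caputo \<alpha> u 0 = 0 \<and> nderiv 1 u 0 = 0 \<and> nderiv 2 u 0 = 0 \<and>
     u 1 + nderiv 1 u 1 = nderiv 1 u \<eta>"

end

theory Submission
  imports Defs
begin

text \<open>
  Write \<open>F u t = \<integral>\<^sub>0\<^sup>t a(s) f(s, u(s)) ds\<close> and \<open>H u = (F u)\<^sup>q\<^sup>-\<^sup>1\<close>. Integrating the equation once gives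
  \<open>D\<^sup>\<alpha> u = - H u\<close>, and the initial conditions turn the problem into the fixed point equation
  \<open>u = c - I\<^sup>\<alpha> (H u)\<close>, where \<open>I\<close> is the Riemann--Liouville integral and the constant \<open>c\<close> is read off the
  condition at \<open>1\<close> and \<open>\<eta>\<close>. The lower bound on \<open>a f\<close> gives \<open>F u t \<ge> \<mu> t\<^sup>\<sigma>\<close>, so by the mean value theorem
  \<open>H\<close> is Lipschitz with the weight \<open>(q - 1) (\<mu> t\<^sup>\<sigma>)\<^sup>q\<^sup>-\<^sup>2\<close> (note \<open>q < 2\<close>), and integrating this weight against
  the kernel produces the Beta function: the bound on \<open>k\<close> says exactly that the operator is a
  contraction in the supremum norm. For \<open>\<alpha> < 3\<close> a fixed point has the integrable third derivative
  \<open>- I\<^sup>\<alpha>\<^sup>-\<^sup>2 ((H u)')\<close>, and the semigroup law of \<open>I\<close> recovers \<open>D\<^sup>\<alpha> u = - I\<^sup>1 ((H u)') = - H u\<close>.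
\<close>

section \<open>Riemann--Liouville integrals\<close>

text \<open>The open interval keeps both ends out: the kernel is singular at \<open>t\<close> when
  \<open>b < 1\<close>, the functions integrated may be singular at 0, and
  \<open>0 powr 0 = 0\<close> would spoil the pointwise identity of the kernel of order one with
  1.\<close>

definition rl_integral :: "real \<Rightarrow> (real \<Rightarrow> real) \<Rightarrow> real \<Rightarrow> real" where
  "rl_integral b f t = (LINT s:{0<..<t}|lborel. (t - s) powr (b - 1) * f s) / Gamma b"

text \<open>The substitution \<open>s = r + (t - r) * x\<close> leads to Euler's integral; the
  exponents of \<open>t - r\<close> from the two factors and the Jacobian add up to
  \<open>a + b - 1\<close>. Using the nonnegative integral yields integrability along with the
  value.\<close>

lemma nn_integral_Beta_kernel:
  fixes a b r t :: real
  assumes "a > 0" "b > 0" "r < t"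
  shows "(\<integral>\<^sup>+s. ennreal (indicator {r<..<t} s * ((t - s) powr (a - 1) * (s - r) powr (b - 1))) \<partial>lborel)
          = ennreal (Beta a b * (t - r) powr (a + b - 1))"
proof -
  define d where "d = t - r"
  have d: "d > 0" using assms by (simp add: d_def)
  have B: "(\<integral>\<^sup>+x. ennreal (indicator {0..1} x * (x powr (b - 1) * (1 - x) powr (a - 1))) \<partial>lborel)
            = ennreal (Beta b a)"
    using has_integral_Beta_real[OF assms(2,1)]
    by (subst nn_integral_has_integral_lebesgue) (auto simp: mult.commute)
  have "(\<integral>\<^sup>+s. ennreal (indicator {r<..<t} s * ((t - s) powr (a - 1) * (s - r) powr (b - 1))) \<partial>lborel)
     = \<bar>d\<bar> * (\<integral>\<^sup>+x. ennreal (indicator {r<..<t} (r + d * x) *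
          ((t - (r + d * x)) powr (a - 1) * (r + d * x - r) powr (b - 1))) \<partial>lborel)"
    by (rule nn_integral_real_affine) (use d in auto)
  also have "(\<integral>\<^sup>+x. ennreal (indicator {r<..<t} (r + d * x) *
          ((t - (r + d * x)) powr (a - 1) * (r + d * x - r) powr (b - 1))) \<partial>lborel)
     = (\<integral>\<^sup>+x. ennreal (d powr (a + b - 2)) *
          ennreal (indicator {0..1} x * (x powr (b - 1) * (1 - x) powr (a - 1))) \<partial>lborel)"
  proof (rule nn_integral_cong)
    fix x :: real
    have "r + d * x < t \<longleftrightarrow> d * x < d * 1" by (auto simp: d_def)
    then have i: "r + d * x \<in> {r<..<t} \<longleftrightarrow> x \<in> {0<..<1}"
      using d by (simp add: zero_less_mult_iff mult_less_cancel_left)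
    have e: "t - (r + d * x) = d * (1 - x)" by (simp add: d_def algebra_simps)
    have "d powr (a + b - 2) = d powr (a - 1) * d powr (b - 1)"
      by (simp add: powr_add [symmetric] algebra_simps)
    then have "(d * (1 - x)) powr (a - 1) * (d * x) powr (b - 1) =
        d powr (a + b - 2) * (x powr (b - 1) * (1 - x) powr (a - 1))" if "x \<in> {0<..<1}"
      using that d by (simp add: powr_mult)
    \<comment> \<open>Since \<open>0 powr y = 0\<close>, the end points contribute nothing, so the
      open interval matches the closed one.\<close>
    moreover have "x = 0 \<or> x = 1 \<Longrightarrow> x powr (b - 1) * (1 - x) powr (a - 1) = 0" by auto
    ultimately show "ennreal (indicator {r<..<t} (r + d * x) *
          ((t - (r + d * x)) powr (a - 1) * (r + d * x - r) powr (b - 1)))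
       = ennreal (d powr (a + b - 2)) *
          ennreal (indicator {0..1} x * (x powr (b - 1) * (1 - x) powr (a - 1)))"
      unfolding e using i
      by (cases "x \<in> {0<..<1}"; cases "x = 0 \<or> x = 1") (auto simp: indicator_def ennreal_mult')
  qed
  also have "\<dots> = ennreal (d powr (a + b - 2)) * ennreal (Beta b a)"
    by (subst nn_integral_cmult) (use B in auto)
  also have "ennreal \<bar>d\<bar> * \<dots> = ennreal (Beta a b * d powr (a + b - 1))"
  proof -
    have "d * d powr (a + b - 2) = d powr (a + b - 1)"
      using d powr_add[of d 1 "a + b - 2"] by simp
    then have "Beta a b * d powr (a + b - 1) = d * (d powr (a + b - 2) * Beta b a)"
      by (simp add: Beta_commute[of b a])
    then show ?thesis using d by (simp only: ennreal_mult' powr_ge_zero less_imp_le abs_of_pos)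
  qed
  finally show ?thesis by (simp add: d_def)
qed

lemma Beta_kernel:
  fixes a b r t :: real
  assumes "a > 0" "b > 0" "r < t"
  shows "has_bochner_integral lborel
           (\<lambda>s. indicator {r<..<t} s * ((t - s) powr (a - 1) * (s - r) powr (b - 1)))
           (Beta a b * (t - r) powr (a + b - 1))"
proof (rule has_bochner_integral_nn_integral)
  show "0 \<le> Beta a b * (t - r) powr (a + b - 1)"
    using assms by (simp add: Beta_def Gamma_real_nonneg)
qed (use nn_integral_Beta_kernel[OF assms] in auto)

lemma rl_integral_powr:
  fixes b c t :: real
  assumes "b > 0" "c > -1" "t > 0"
  shows "set_integrable lborel {0<..<t} (\<lambda>s. (t - s) powr (b - 1) * s powr c)"
    and "rl_integral b (\<lambda>s. s powr c) t = Beta b (c + 1) / Gamma b * t powr (b + c)"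
proof -
  note B = Beta_kernel[OF assms(1) _ assms(3), of "c + 1"]
  show "set_integrable lborel {0<..<t} (\<lambda>s. (t - s) powr (b - 1) * s powr c)"
    using B assms by (simp add: set_integrable_def has_bochner_integral_iff)
  show "rl_integral b (\<lambda>s. s powr c) t = Beta b (c + 1) / Gamma b * t powr (b + c)"
    using B assms by (simp add: rl_integral_def set_lebesgue_integral_def has_bochner_integral_iff)
qed

lemma rl_integral_cong:
  assumes "\<And>s. s \<in> {0<..<t} \<Longrightarrow> f s = g s"
  shows "rl_integral b f t = rl_integral b g t"
  unfolding rl_integral_def using assms by (intro arg_cong2[where f = "(/)"] set_lebesgue_integral_cong) auto

lemma rl_integral_minus: "rl_integral b (\<lambda>s. - f s) t = - rl_integral b f t"
  by (simp add: rl_integral_def set_lebesgue_integral_def)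

lemma rl_integral_0 [simp]: "rl_integral b f 0 = 0"
  by (simp add: rl_integral_def set_lebesgue_integral_def)

lemma set_integrable_dominated:
  fixes f g :: "real \<Rightarrow> real"
  assumes "set_integrable lborel A g" "set_borel_measurable lborel A f"
    and "\<And>x. x \<in> A \<Longrightarrow> \<bar>f x\<bar> \<le> g x"
  shows "set_integrable lborel A f"
  using assms(1,2) by (rule set_integrable_bound) (use assms(3) in force)

text \<open>Fubini on the triangle \<open>r < s < t\<close> leaves a Beta integral in \<open>s\<close>.\<close>

lemma rl_integral_semigroup:
  fixes a b t :: real
  assumes ab: "a > 0" "b > 0"
    and int: "set_integrable lborel {0<..<t} (\<lambda>s. (t - s) powr (a + b - 1) * f s)"
  shows "set_integrable lborel {0<..<t} (\<lambda>s. (t - s) powr (a - 1) * rl_integral b f s)"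
    and "rl_integral a (rl_integral b f) t = rl_integral (a + b) f t"
proof -
  define g where "g = (\<lambda>s. indicator {0<..<t} s * f s)"
  \<comment> \<open>No measurability of \<open>f\<close> is assumed. The kernel is nonzero on
    \<open>{0<..<t}\<close>, so dividing the integrable product by it shows that \<open>g\<close> is
    measurable.\<close>
  have g: "g = (\<lambda>s. (t - s) powr (- (a + b - 1)) *
      (indicator {0<..<t} s *\<^sub>R ((t - s) powr (a + b - 1) * f s)))"
  proof
    fix s show "g s = (t - s) powr (- (a + b - 1)) *
      (indicator {0<..<t} s *\<^sub>R ((t - s) powr (a + b - 1) * f s))"
      by (cases "s \<in> {0<..<t}") (simp_all add: g_def powr_minus del: minus_diff_eq)
  qed
  have [measurable]: "g \<in> borel_measurable borel"
    unfolding g using borel_measurable_integrable[OF int[unfolded set_integrable_def]] by measurable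
  define H where "H = (\<lambda>r s. (if r < s \<and> s < t then (t - s) powr (a - 1) * (s - r) powr (b - 1) else 0) * g r)"
  have H_meas: "case_prod H \<in> borel_measurable (lborel \<Otimes>\<^sub>M lborel)"
    unfolding H_def by measurable
  have slice: "has_bochner_integral lborel (\<lambda>s. (if r < s \<and> s < t then (t - s) powr (a - 1) * (s - r) powr (b - 1) else 0) * c)
      (Beta a b * (t - r) powr (a + b - 1) * c)" if "r < t" for r c
  proof -
    have "(\<lambda>s. (if r < s \<and> s < t then (t - s) powr (a - 1) * (s - r) powr (b - 1) else 0))
       = (\<lambda>s. indicator {r<..<t} s * ((t - s) powr (a - 1) * (s - r) powr (b - 1)))"
      by (auto simp: indicator_def)
    with Beta_kernel[OF ab that] show ?thesis
      by (simp add: has_bochner_integral_mult_left)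
  qed
  have g0: "g r = 0" if "\<not> r < t" for r using that by (auto simp: g_def)
  have Hs: "has_bochner_integral lborel (\<lambda>s. H r s) (Beta a b * (t - r) powr (a + b - 1) * g r)" for r
    unfolding H_def using slice[of r "g r"] g0[of r] by (cases "r < t") auto
  \<comment> \<open>The kernel is nonnegative, so the same Beta integral evaluates the norm, as
    Fubini's integrability criterion requires.\<close>
  have Hn: "has_bochner_integral lborel (\<lambda>s. norm (H r s)) (Beta a b * (t - r) powr (a + b - 1) * \<bar>g r\<bar>)" for r
  proof -
    have "(\<lambda>s. norm (H r s)) = (\<lambda>s. (if r < s \<and> s < t then (t - s) powr (a - 1) * (s - r) powr (b - 1) else 0) * \<bar>g r\<bar>)"
      by (rule ext) (auto simp: H_def abs_mult)
    then show ?thesis using slice[of r "\<bar>g r\<bar>"] g0[of r] by (cases "r < t") auto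
  qed
  have gi: "integrable lborel (\<lambda>r. (t - r) powr (a + b - 1) * g r)"
    using int unfolding set_integrable_def g_def by (simp add: mult.left_commute)
  have H_int: "integrable (lborel \<Otimes>\<^sub>M lborel) (case_prod H)"
  proof (rule lborel_pair.Fubini_integrable[OF H_meas])
    have "(\<lambda>r. LINT s|lborel. norm (case_prod H (r, s)))
        = (\<lambda>r. Beta a b * norm ((t - r) powr (a + b - 1) * g r))"
      using Hn by (simp add: has_bochner_integral_iff abs_mult mult.assoc)
    then show "integrable lborel (\<lambda>r. LINT s|lborel. norm (case_prod H (r, s)))"
      using gi by (simp only:) (intro integrable_mult_right integrable_norm)
    show "AE r in lborel. integrable lborel (\<lambda>s. case_prod H (r, s))"
      using Hs by (simp add: has_bochner_integral_iff)
  qed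
  \<comment> \<open>Integrating in \<open>r\<close> first gives the inner integral of order
    \<open>b\<close>, up to its normalising factor \<open>Gamma b\<close>.\<close>
  have inner: "(LINT r|lborel. H r s)
     = indicator {0<..<t} s *\<^sub>R ((t - s) powr (a - 1) * rl_integral b f s) * Gamma b" for s
  proof -
    have "Gamma b > 0" using ab by (simp add: Gamma_real_pos)
    moreover have "(LINT r|lborel. H r s) = indicator {0<..<t} s * ((t - s) powr (a - 1) *
        (LINT r|lborel. indicator {0<..<s} r *\<^sub>R ((s - r) powr (b - 1) * f r)))"
    proof (cases "s \<in> {0<..<t}")
      case True
      have "(LINT r|lborel. H r s) = (LINT r|lborel. (t - s) powr (a - 1) *
          (indicator {0<..<s} r *\<^sub>R ((s - r) powr (b - 1) * f r)))"
        by (rule Bochner_Integration.integral_cong)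
           (use True in \<open>auto simp: H_def g_def indicator_def\<close>)
      then show ?thesis using True by simp
    next
      case False
      then have "H r s = 0" for r by (auto simp: H_def g_def indicator_def)
      with False show ?thesis by simp
    qed
    ultimately show ?thesis by (simp add: rl_integral_def set_lebesgue_integral_def)
  qed
  have Gb: "Gamma b \<noteq> 0" "Gamma a \<noteq> 0" "Gamma (a + b) \<noteq> 0"
    using ab by (metis Gamma_real_pos add_pos_pos less_irrefl)+
  have "integrable lborel (\<lambda>s. LINT r|lborel. H r s)"
    using lborel_pair.integrable_snd[OF H_int] .
  then show I: "set_integrable lborel {0<..<t} (\<lambda>s. (t - s) powr (a - 1) * rl_integral b f s)"
    unfolding inner set_integrable_def using Gb by simp
  have "(LINT s|lborel. LINT r|lborel. H r s) = (LINT r|lborel. LINT s|lborel. H r s)"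
    by (rule lborel_pair.Fubini_integral[OF H_int])
  also have "\<dots> = (LINT r|lborel. Beta a b * ((t - r) powr (a + b - 1) * g r))"
    using Hs by (simp add: has_bochner_integral_iff mult.assoc)
  also have "\<dots> = Beta a b * (LINT r:{0<..<t}|lborel. (t - r) powr (a + b - 1) * f r)"
    by (simp add: g_def set_lebesgue_integral_def mult.left_commute)
  finally have "Gamma b * (LINT s:{0<..<t}|lborel. (t - s) powr (a - 1) * rl_integral b f s) =
      Beta a b * (LINT r:{0<..<t}|lborel. (t - r) powr (a + b - 1) * f r)"
    unfolding inner set_lebesgue_integral_def by (simp add: mult.commute)
  then show "rl_integral a (rl_integral b f) t = rl_integral (a + b) f t"
    using Gb unfolding rl_integral_def[of a] rl_integral_def[of "a + b"]
    by (simp add: Beta_def field_simps)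
qed

section \<open>Integrability on the unit interval, order one, and continuity in the upper
  limit\<close>

lemma set_integrable_unit_interval: "continuous_on {0..1} (g :: real \<Rightarrow> real) \<Longrightarrow> set_integrable lborel {0<..<1} g"
  by (rule set_integrable_subset[OF borel_integrable_atLeastAtMost']) auto

lemma set_borel_measurable_unit:
  fixes g :: "real \<Rightarrow> real"
  assumes "continuous_on {0<..1} g"
  shows "set_borel_measurable lborel {0<..<1} g"
proof -
  have "continuous_on {0<..<1} g" using assms by (rule continuous_on_subset) auto
  then show ?thesis unfolding set_borel_measurable_def
    using borel_measurable_continuous_on_indicator[of "{0<..<1}" g] by simp
qed

text \<open>For \<open>b \<ge> 1\<close> the kernel is at most 1 on the unit interval, so
  integrability of \<open>f\<close> is enough.\<close>

lemma kernel_integrable: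
  fixes b t :: real
  assumes f: "set_integrable lborel {0<..<1} f" and "b \<ge> 1" "t \<in> {0..1}"
  shows "set_integrable lborel {0<..<t} (\<lambda>s. (t - s) powr (b - 1) * f s)"
proof (rule set_integrable_bound)
  show f': "set_integrable lborel {0<..<t} f"
    by (rule set_integrable_subset[OF f]) (use assms in auto)
  have "(\<lambda>s. indicator {0<..<t} s *\<^sub>R f s) \<in> borel_measurable lborel"
    using f' unfolding set_integrable_def by (rule borel_measurable_integrable)
  then have "(\<lambda>s. (t - s) powr (b - 1) * (indicator {0<..<t} s *\<^sub>R f s)) \<in> borel_measurable lborel"
    by measurable
  then show "set_borel_measurable lborel {0<..<t} (\<lambda>s. (t - s) powr (b - 1) * f s)"
    unfolding set_borel_measurable_def by (simp add: mult.left_commute)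
  have "(t - s) powr (b - 1) \<le> 1" if "s \<in> {0<..<t}" for s
    using that assms by (intro powr_le1) auto
  then show "AE s in lborel. s \<in> {0<..<t} \<longrightarrow> norm ((t - s) powr (b - 1) * f s) \<le> norm (f s)"
    by (auto simp: abs_mult intro!: mult_left_le_one_le)
qed

text \<open>Passage from the Lebesgue integral over the open interval to the gauge integral over the
  closed one, for which the fundamental theorem of calculus is available.\<close>

lemma rl_integral_1:
  assumes "set_integrable lborel {0<..<1} f" "t \<in> {0..1}"
  shows "f integrable_on {0..t}" "rl_integral 1 f t = integral {0..t} f"
proof -
  have f: "set_integrable lborel {0<..<t} f"
    by (rule set_integrable_subset[OF assms(1)]) (use assms in auto)
  show "f integrable_on {0..t}"
    using set_borel_integral_eq_integral(1)[OF f] by (simp add: integrable_on_Icc_iff_Ioo)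
  have "rl_integral 1 f t = (LINT s:{0<..<t}|lborel. f s)"
    unfolding rl_integral_def by (simp, intro set_lebesgue_integral_cong) auto
  then show "rl_integral 1 f t = integral {0..t} f"
    using set_borel_integral_eq_integral(2)[OF f] by (simp add: integral_open_interval_real)
qed

lemma continuous_on_rl_integral_1:
  assumes "set_integrable lborel {0<..<1} f"
  shows "continuous_on {0..1} (rl_integral 1 f)"
  using indefinite_integral_continuous_1[OF rl_integral_1(1)[OF assms, of 1]]
  by (subst continuous_on_cong[OF refl rl_integral_1(2)[OF assms]]) auto

lemma rl_integral_1_has_vector_derivative:
  assumes "set_integrable lborel {0<..<1} f" "t \<in> {0..1}" "continuous (at t within {0..1}) f"
  shows "(rl_integral 1 f has_vector_derivative f t) (at t within {0..1})"
proof (rule has_vector_derivative_transform[OF assms(2)])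
  show "rl_integral 1 f x = integral {0..x} f" if "x \<in> {0..1}" for x
    using that by (rule rl_integral_1(2)[OF assms(1)])
  show "((\<lambda>x. integral {0..x} f) has_vector_derivative f t) (at t within {0..1})"
    using integral_has_vector_derivative_continuous_at[of f 0 1 t "{}"]
      rl_integral_1(1)[OF assms(1), of 1] assms by simp
qed

text \<open>Differentiability is asked for in the interior only and \<open>g'\<close> need only be
  integrable, which covers derivatives that blow up at 0.\<close>

lemma rl_integral_1_FTC:
  assumes "continuous_on {0..1} g"
    and "\<And>x. x \<in> {0<..<1} \<Longrightarrow> (g has_vector_derivative g' x) (at x)"
    and "set_integrable lborel {0<..<1} g'" "t \<in> {0..1}"
  shows "rl_integral 1 g' t = g t - g 0"
proof -
  have "(g' has_integral (g t - g 0)) {0..t}"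
    by (rule fundamental_theorem_of_calculus_interior)
       (use assms in \<open>auto intro: continuous_on_subset\<close>)
  then show ?thesis
    using rl_integral_1(2)[OF assms(3,4)] by (simp add: integral_unique)
qed

text \<open>By the semigroup law, order \<open>1 + b\<close> is one ordinary integration after order
  \<open>b\<close>. Hence it is continuous even where order \<open>b\<close> is singular, and
  differentiable wherever order \<open>b\<close> is continuous.\<close>

lemma rl_integral_1_plus:
  fixes b :: real
  assumes f: "set_integrable lborel {0<..<1} f" and b: "b > 0"
  shows "set_integrable lborel {0<..<1} (rl_integral b f)"
    and "t \<in> {0..1} \<Longrightarrow> rl_integral 1 (rl_integral b f) t = rl_integral (1 + b) f t"
    and "continuous_on {0..1} (rl_integral (1 + b) f)"
    and "t \<in> {0..1} \<Longrightarrow> continuous (at t within {0..1}) (rl_integral b f) \<Longrightarrow>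
      (rl_integral (1 + b) f has_vector_derivative rl_integral b f t) (at t within {0..1})"
proof -
  have k: "set_integrable lborel {0<..<t} (\<lambda>s. (t - s) powr (1 + b - 1) * f s)" if "t \<in> {0..1}" for t
    by (rule kernel_integrable[OF f]) (use that b in auto)
  have "set_integrable lborel {0<..<1} (\<lambda>s. (1 - s) powr (1 - 1) * rl_integral b f s)"
    by (rule rl_integral_semigroup(1)) (use b k[of 1] in auto)
  also have "?this \<longleftrightarrow> set_integrable lborel {0<..<1} (rl_integral b f)"
    by (rule set_integrable_cong) auto
  finally show i: "set_integrable lborel {0<..<1} (rl_integral b f)" .
  have e: "rl_integral 1 (rl_integral b f) t = rl_integral (1 + b) f t" if "t \<in> {0..1}" for t
    by (rule rl_integral_semigroup(2)) (use b k that in auto)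
  then show "t \<in> {0..1} \<Longrightarrow> rl_integral 1 (rl_integral b f) t = rl_integral (1 + b) f t" .
  show "continuous_on {0..1} (rl_integral (1 + b) f)"
    using continuous_on_rl_integral_1[OF i] by (subst continuous_on_cong[OF refl e[symmetric]])
  show "(rl_integral (1 + b) f has_vector_derivative rl_integral b f t) (at t within {0..1})"
    if "t \<in> {0..1}" "continuous (at t within {0..1}) (rl_integral b f)"
    by (rule has_vector_derivative_transform[OF that(1) e[symmetric]
          rl_integral_1_has_vector_derivative[OF i that]])
qed

text \<open>Substituting \<open>s = t x\<close> moves the dependence on \<open>t\<close> out of the singular kernel.\<close>

lemma continuous_on_rl_integral:
  fixes b c C :: real
  assumes b: "b > 0" and c: "c > -1" and f: "continuous_on {0<..1} f"
    and bound: "\<And>s. s \<in> {0<..1} \<Longrightarrow> \<bar>f s\<bar> \<le> C * s powr c"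
  shows "continuous_on {0<..1} (rl_integral b f)"
proof -
  \<comment> \<open>The factor \<open>t powr (- c)\<close> cancels the growth allowed by
    \<open>bound\<close>, so that \<open>C * (1 - x) powr (b - 1) * x powr c\<close> dominates the
    integrand for all \<open>t\<close> at once.\<close>
  define G where "G = (\<lambda>t x. indicator {0<..<1} x *\<^sub>R ((1 - x) powr (b - 1) * (t powr (- c) * f (t * x))))"
  have eq: "rl_integral b f t = t powr (b + c) * (LINT x|lborel. G t x) / Gamma b" if t: "t \<in> {0<..1}" for t
  proof -
    have "(LINT s:{0<..<t}|lborel. (t - s) powr (b - 1) * f s) =
        \<bar>t\<bar> *\<^sub>R (LINT x|lborel. indicator {0<..<t} (0 + t * x) *\<^sub>R
          ((t - (0 + t * x)) powr (b - 1) * f (0 + t * x)))"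
      unfolding set_lebesgue_integral_def by (rule lborel_integral_real_affine) (use t in auto)
    also have "(LINT x|lborel. indicator {0<..<t} (0 + t * x) *\<^sub>R
          ((t - (0 + t * x)) powr (b - 1) * f (0 + t * x))) =
        (LINT x|lborel. t powr (b + c - 1) * G t x)"
    proof (rule Bochner_Integration.integral_cong[OF refl])
      fix x
      have i: "t * x \<in> {0<..<t} \<longleftrightarrow> x \<in> {0<..<1}"
        using t mult_less_cancel_left_pos[of t x 1] by (simp add: zero_less_mult_iff)
      have "t powr (b + c - 1) * t powr (- c) = t powr (b - 1)"
        by (simp flip: powr_add)
      moreover have "(t - t * x) powr (b - 1) = t powr (b - 1) * (1 - x) powr (b - 1)" if "x < 1"
        using that t by (simp add: right_diff_distrib flip: powr_mult)
      ultimately show "indicator {0<..<t} (0 + t * x) *\<^sub>R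
          ((t - (0 + t * x)) powr (b - 1) * f (0 + t * x)) = t powr (b + c - 1) * G t x"
        using i by (cases "x \<in> {0<..<1}") (simp_all add: G_def)
    qed
    finally have "(LINT s:{0<..<t}|lborel. (t - s) powr (b - 1) * f s) =
        t * t powr (b + c - 1) * (LINT x|lborel. G t x)"
      using t by simp
    moreover have "t * t powr (b + c - 1) = t powr (b + c)"
      using t powr_add[of t 1 "b + c - 1"] by simp
    ultimately show ?thesis by (simp add: rl_integral_def)
  qed
  have "continuous_on {0<..1} (\<lambda>t. LINT x|lborel. G t x)"
    unfolding continuous_on_sequentially
  proof (intro allI ballI impI, elim conjE)
    fix a t assume a: "a \<in> {0<..1}" and t: "\<forall>n. t n \<in> {0<..1::real}" "t \<longlonglongrightarrow> a"
    have meas: "G t \<in> borel_measurable lborel" if t: "t \<in> {0<..1}" for t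
    proof -
      have "continuous_on {0<..<1} (\<lambda>x. f (t * x))"
        by (rule continuous_on_compose2[OF f]) (use t in \<open>auto intro!: continuous_intros mult_le_one\<close>)
      then have "G t \<in> borel_measurable borel" unfolding G_def
        by (intro borel_measurable_continuous_on_indicator continuous_intros) auto
      then show ?thesis by simp
    qed
    show "((\<lambda>t. LINT x|lborel. G t x) \<circ> t) \<longlonglongrightarrow> (LINT x|lborel. G a x)"
      unfolding o_def
    proof (rule integral_dominated_convergence)
      show "integrable lborel (\<lambda>x. C * (indicator {0<..<1} x *\<^sub>R ((1 - x) powr (b - 1) * x powr c)))"
        using rl_integral_powr(1)[OF b c, of 1] unfolding set_integrable_def
        by (intro integrable_mult_right) auto
      have "(\<lambda>n. G (t n) x) \<longlonglongrightarrow> G a x" for x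
      proof (cases "x \<in> {0<..<1}")
        case True
        have "(\<lambda>n. f (t n * x)) \<longlonglongrightarrow> f (a * x)"
        proof (rule continuous_on_tendsto_compose[OF f])
          show "(\<lambda>n. t n * x) \<longlonglongrightarrow> a * x" using t by (intro tendsto_intros)
        qed (use a t True in \<open>auto intro!: mult_le_one always_eventually\<close>)
        then show ?thesis unfolding G_def using a t by (intro tendsto_intros) auto
      qed (simp add: G_def)
      then show "AE x in lborel. (\<lambda>n. G (t n) x) \<longlonglongrightarrow> G a x" by simp
      show "AE x in lborel. norm (G (t n) x) \<le>
          C * (indicator {0<..<1} x *\<^sub>R ((1 - x) powr (b - 1) * x powr c))" for n
      proof (rule AE_I2)
        fix x
        show "norm (G (t n) x) \<le> C * (indicator {0<..<1} x *\<^sub>R ((1 - x) powr (b - 1) * x powr c))"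
        proof (cases "x \<in> {0<..<1}")
          case True
          have tn: "0 < t n" "t n \<le> 1" using t by auto
          have "\<bar>f (t n * x)\<bar> \<le> C * (t n * x) powr c"
            using tn True by (intro bound) (auto intro!: mult_le_one)
          then have "t n powr (- c) * \<bar>f (t n * x)\<bar> \<le> t n powr (- c) * (C * (t n powr c * x powr c))"
            using tn True by (intro mult_left_mono) (auto simp: powr_mult)
          also have "\<dots> = C * x powr c"
            using tn by (simp add: powr_minus)
          finally have "(1 - x) powr (b - 1) * (t n powr (- c) * \<bar>f (t n * x)\<bar>)
              \<le> (1 - x) powr (b - 1) * (C * x powr c)"
            by (intro mult_left_mono) auto
          then show ?thesis using True by (simp add: G_def abs_mult mult.left_commute)
        qed (simp add: G_def)
      qed
    qed (use meas a t in auto)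
  qed
  then have "continuous_on {0<..1} (\<lambda>t. t powr (b + c) * (LINT x|lborel. G t x) / Gamma b)"
    using Gamma_real_pos[OF b] by (intro continuous_intros) auto
  then show ?thesis by (subst continuous_on_cong[OF refl eq])
qed

section \<open>Positivity, linearity and monotonicity in the end point\<close>

lemma rl_integral_nonneg:
  assumes "b > 0" "\<And>s. s \<in> {0<..<t} \<Longrightarrow> f s \<ge> 0"
  shows "rl_integral b f t \<ge> 0"
  unfolding rl_integral_def set_lebesgue_integral_def using assms
  by (intro divide_nonneg_nonneg Bochner_Integration.integral_nonneg)
     (auto simp: indicator_def Gamma_real_nonneg)

lemma rl_integral_cmult: "rl_integral b (\<lambda>s. c * f s) t = c * rl_integral b f t"
  by (simp add: rl_integral_def set_lebesgue_integral_def mult.left_commute)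

lemma rl_integral_add:
  assumes "set_integrable lborel {0<..<1} f" "set_integrable lborel {0<..<1} g" "b \<ge> 1" "t \<in> {0..1}"
  shows "rl_integral b (\<lambda>s. f s + g s) t = rl_integral b f t + rl_integral b g t"
  using set_integral_add(2)[OF kernel_integrable[OF assms(1,3,4)] kernel_integrable[OF assms(2,3,4)]]
  by (simp add: rl_integral_def distrib_left add_divide_distrib)

text \<open>For \<open>b \<ge> 1\<close> both the kernel and the interval of integration grow with
  the end point.\<close>

lemma rl_integral_mono_endpoint:
  assumes f: "set_integrable lborel {0<..<1} f" and b: "b \<ge> 1" and t: "t \<in> {0..1}"
    and pos: "\<And>s. s \<in> {0<..<1} \<Longrightarrow> f s \<ge> 0"
  shows "rl_integral b f t \<le> rl_integral b f 1"
proof -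
  have "(LINT s:{0<..<t}|lborel. (t - s) powr (b - 1) * f s) \<le>
      (LINT s:{0<..<1}|lborel. (1 - s) powr (b - 1) * f s)"
    unfolding set_lebesgue_integral_def
  proof (rule integral_mono)
    show "integrable lborel (\<lambda>s. indicator {0<..<t} s *\<^sub>R ((t - s) powr (b - 1) * f s))"
      "integrable lborel (\<lambda>s. indicator {0<..<1} s *\<^sub>R ((1 - s) powr (b - 1) * f s))"
      using kernel_integrable[OF f b t] kernel_integrable[OF f b, of 1] by (auto simp: set_integrable_def)
    fix s
    have "(t - s) powr (b - 1) * f s \<le> (1 - s) powr (b - 1) * f s" if "s \<in> {0<..<t}"
      using that t b by (intro mult_right_mono powr_mono2 pos) auto
    then show "indicator {0<..<t} s *\<^sub>R ((t - s) powr (b - 1) * f s) \<le>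
        indicator {0<..<1} s *\<^sub>R ((1 - s) powr (b - 1) * f s)"
      using t pos[of s] by (auto simp: indicator_def)
  qed
  then show ?thesis
    unfolding rl_integral_def using Gamma_real_pos[of b] b by (intro divide_right_mono) auto
qed

text \<open>Both \<open>m + d\<close> and \<open>m - d\<close> are nonnegative, so monotonicity in
  the end point applies to each. This bounds the difference by the integral of \<open>m\<close> at 1
  alone, where the triangle inequality would add the one at \<open>t\<close>.\<close>

lemma rl_integral_diff_bound:
  assumes d: "set_integrable lborel {0<..<1} d" and m: "set_integrable lborel {0<..<1} m"
    and b: "b \<ge> 1" and t: "t \<in> {0..1}"
    and dm: "\<And>s. s \<in> {0<..<1} \<Longrightarrow> \<bar>d s\<bar> \<le> m s"
  shows "\<bar>rl_integral b d 1 - rl_integral b d t\<bar> \<le> rl_integral b m 1"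
proof -
  have d': "set_integrable lborel {0<..<1} (\<lambda>s. - d s)"
    using d by (simp add: set_integrable_def)
  have "rl_integral b (\<lambda>s. m s + d s) t \<le> rl_integral b (\<lambda>s. m s + d s) 1"
    using b t by (intro rl_integral_mono_endpoint set_integral_add m d) (use dm in \<open>force+\<close>)
  moreover have "rl_integral b (\<lambda>s. m s + - d s) t \<le> rl_integral b (\<lambda>s. m s + - d s) 1"
    using b t by (intro rl_integral_mono_endpoint set_integral_add m d') (use dm in \<open>force+\<close>)
  moreover have "rl_integral b m t \<ge> 0"
  proof (rule rl_integral_nonneg)
    show "m s \<ge> 0" if "s \<in> {0<..<t}" for s using dm[of s] that t by auto
  qed (use b in auto)
  ultimately show ?thesis
    using rl_integral_add[OF m d b t] rl_integral_add[OF m d b, of 1]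
      rl_integral_add[OF m d' b t] rl_integral_add[OF m d' b, of 1]
    by (simp add: rl_integral_minus)
qed

section \<open>The contraction\<close>

text \<open>Mean value theorem: as \<open>r \<le> 1\<close>, the derivative
  \<open>r * z powr (r - 1)\<close> does not increase, hence is largest at the lower end
  \<open>m\<close>.\<close>

lemma powr_diff_bound:
  fixes r m x y :: real
  assumes "0 < r" "r \<le> 1" "0 < m" "m \<le> x" "m \<le> y"
  shows "\<bar>x powr r - y powr r\<bar> \<le> r * m powr (r - 1) * \<bar>x - y\<bar>"
proof -
  have "norm (x powr r - y powr r) \<le> r * m powr (r - 1) * norm (x - y)"
  proof (rule field_differentiable_bound[where S = "{m..}" and f' = "\<lambda>z. r * z powr (r - 1)"])
    show "((\<lambda>z. z powr r) has_field_derivative r * z powr (r - 1)) (at z within {m..})"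
      if "z \<in> {m..}" for z
      by (rule DERIV_subset[OF has_real_derivative_powr]) (use that assms in auto)
    show "norm (r * z powr (r - 1)) \<le> r * m powr (r - 1)" if "z \<in> {m..}" for z
      using that assms by (auto simp: abs_mult intro!: mult_left_mono powr_mono2')
  qed (use assms in auto)
  then show ?thesis by simp
qed

text \<open>By the functional equation of Gamma, the first summand is the second divided by
  \<open>\<alpha> - 1 + \<beta>\<close>. This connects the two kernels to the single fraction
  bounding \<open>k\<close>.\<close>

lemma Beta_Suc_ratio:
  fixes \<alpha> \<beta> :: real
  assumes "\<alpha> > 1" "\<beta> > 0"
  shows "Beta \<alpha> \<beta> / Gamma \<alpha> + Beta (\<alpha> - 1) \<beta> / Gamma (\<alpha> - 1) =
    (\<alpha> + \<beta>) * Beta (\<alpha> - 1) \<beta> / ((\<alpha> - 1 + \<beta>) * Gamma (\<alpha> - 1))"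
proof -
  have pos: "x \<notin> \<int>\<^sub>\<le>\<^sub>0" if "x > 0" for x :: real
    using that nonpos_Ints_nonpos[of x] by linarith
  have 1: "Gamma \<alpha> = (\<alpha> - 1) * Gamma (\<alpha> - 1)"
    using Gamma_plus1[OF pos, of "\<alpha> - 1"] assms by simp
  have 2: "Gamma (\<alpha> + \<beta>) = (\<alpha> - 1 + \<beta>) * Gamma (\<alpha> - 1 + \<beta>)"
    using Gamma_plus1[OF pos, of "\<alpha> - 1 + \<beta>"] assms by (simp add: algebra_simps)
  have "Gamma (\<alpha> - 1) > 0" "Gamma (\<alpha> - 1 + \<beta>) > 0" using assms by (auto intro: Gamma_real_pos)
  then show ?thesis using assms unfolding Beta_def 1 2
    by (simp add: divide_simps) (simp add: algebra_simps)
qed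

text \<open>For \<open>y\<close> strictly between -1 and 0, \<open>Gamma y\<close> is
  \<open>Gamma (y + 1) / y\<close> and hence negative, while the other two Gamma values are
  positive.\<close>

lemma Beta_nonpos:
  fixes x y :: real
  assumes "x > 1" "-1 < y" "y \<le> 0"
  shows "Beta x y \<le> 0"
proof (cases "y = 0")
  \<comment> \<open>At the pole the convention \<open>Gamma 0 = 0\<close> makes
    \<open>Beta x 0\<close> vanish.\<close>
  case True
  then show ?thesis by (simp add: Beta_def)
next
  case False
  have "y \<notin> \<int>\<^sub>\<le>\<^sub>0"
  proof
    assume "y \<in> \<int>\<^sub>\<le>\<^sub>0"
    then obtain n where "y = of_int n" by (auto elim: nonpos_Ints_cases)
    with assms False show False by simp
  qed
  then have "Gamma (y + 1) = y * Gamma y" by (rule Gamma_plus1)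
  moreover have "Gamma (y + 1) > 0" using assms by (intro Gamma_real_pos) auto
  ultimately have "Gamma y < 0" using assms False by (metis less_eq_real_def mult_nonpos_nonneg not_less)
  moreover have "Gamma x > 0" "Gamma (x + y) > 0" using assms by (auto intro: Gamma_real_pos)
  ultimately show ?thesis by (simp add: Beta_def divide_nonpos_pos mult_nonneg_nonpos)
qed

section \<open>The fixed point operator and its contraction constant\<close>

locale fractional_bvp =
  fixes p q \<alpha> \<eta> \<mu> \<sigma> k :: real
    and f :: "real \<Rightarrow> real \<Rightarrow> real"
    and a :: "real \<Rightarrow> real"
  assumes p: "p > 2" and pq: "1 / p + 1 / q = 1"
    and \<alpha>: "2 < \<alpha>" "\<alpha> \<le> 3"
    and \<eta>: "0 < \<eta>" "\<eta> < 1"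
    and f_cont: "continuous_on ({0..1} \<times> {0..}) (\<lambda>(t, u). f t u)"
    and f_nonneg: "\<forall>t\<in>{0..1}. \<forall>u\<ge>0. f t u \<ge> 0"
    and a_cont: "continuous_on {0..1} a"
    and a_nonneg: "\<forall>t\<in>{0..1}. a t \<ge> 0"
    and a_nz: "\<exists>t\<in>{0..1}. a t \<noteq> 0"
    and \<mu>: "\<mu> > 0" and \<sigma>: "0 < \<sigma>" "\<sigma> < 2 / (2 - q)"
    and af_lower: "\<forall>t\<in>{0<..1}. \<forall>u\<ge>0. a t * f t u \<ge> \<mu> * \<sigma> * t powr (\<sigma> - 1)"
    and f_lip: "\<forall>t\<in>{0..1}. \<forall>u\<ge>0. \<forall>v\<ge>0. \<bar>f t u - f t v\<bar> \<le> k * \<bar>u - v\<bar>"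
    and k_pos: "0 < k"
    and k_less: "k < (\<sigma> * (q - 2) + \<alpha>) * Gamma (\<alpha> - 1)
             / ((q - 1) * \<mu> powr (q - 2) * (\<sigma> * (q - 2) + \<alpha> + 1)
                * Beta (\<alpha> - 1) (\<sigma> * (q - 2) + 1))
           * inverse (integral {0..1} a)"
begin

definition F :: "(real \<Rightarrow> real) \<Rightarrow> real \<Rightarrow> real" where
  "F u t = integral {0..t} (\<lambda>s. a s * f s (u s))"

definition H :: "(real \<Rightarrow> real) \<Rightarrow> real \<Rightarrow> real" where
  "H u t = F u t powr (q - 1)"

text \<open>The derivative of \<open>H u\<close> inside the interval, by the chain rule. The
  exponent \<open>q - 2\<close> is negative, so it may be unbounded near 0.\<close>

definition H' :: "(real \<Rightarrow> real) \<Rightarrow> real \<Rightarrow> real" where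
  "H' u t = (q - 1) * F u t powr (q - 2) * (a t * f t (u t))"

text \<open>Since \<open>u'\<close> is \<open>- rl_integral (\<alpha> - 1) (H u)\<close>, the
  boundary condition fixes the additive constant. Grouping it into two differences makes both
  visibly nonnegative and lets each be estimated on its own.\<close>

definition solution_op :: "(real \<Rightarrow> real) \<Rightarrow> real \<Rightarrow> real" where
  "solution_op u t = (rl_integral \<alpha> (H u) 1 - rl_integral \<alpha> (H u) t) +
     (rl_integral (\<alpha> - 1) (H u) 1 - rl_integral (\<alpha> - 1) (H u) \<eta>)"

definition admissible :: "(real \<Rightarrow> real) \<Rightarrow> bool" where
  "admissible u \<longleftrightarrow> continuous_on {0..1} u \<and> (\<forall>t\<in>{0..1}. u t \<ge> 0)"

lemma q: "1 < q" "q < 2" and pq': "(q - 1) * (p - 1) = 1"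
proof -
  have "q \<noteq> 0" using pq p by auto
  then have "q + p = p * q" using pq p by (simp add: field_simps)
  then have *: "q = p / (p - 1)" using p by (simp add: field_simps)
  show "1 < q" "q < 2" "(q - 1) * (p - 1) = 1" using p unfolding * by (auto simp: field_simps)
qed

lemma a_int_pos: "integral {0..1} a > 0"
proof -
  have "integral {0..1} a \<ge> 0" using a_nonneg by (intro integral_nonneg integrable_continuous_real a_cont) auto
  moreover have "integral {0..1} a \<noteq> 0"
    using integral_eq_0_iff[OF a_cont] a_nonneg a_nz by auto
  ultimately show ?thesis by simp
qed

text \<open>
  The bound on \<open>\<sigma>\<close> alone does not exclude exponents in \<open>(-2, -1]\<close>, but there the value of \<open>Beta\<close>
  given by the Gamma function is at most \<open>0\<close>, so the bound on \<open>k\<close> would contradict \<open>0 < k\<close>.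
\<close>

lemma exponent_gt: "\<sigma> * (q - 2) > -1"
proof -
  have "\<sigma> * (2 - q) < 2" using \<sigma> q by (simp add: field_simps)
  then have c: "\<sigma> * (q - 2) > -2" by (simp add: algebra_simps)
  show "\<sigma> * (q - 2) > -1"
  proof (rule ccontr)
    assume "\<not> ?thesis"
    then have "Beta (\<alpha> - 1) (\<sigma> * (q - 2) + 1) \<le> 0" using c \<alpha> by (intro Beta_nonpos) auto
    moreover have "Gamma (\<alpha> - 1) > 0" using \<alpha> by (intro Gamma_real_pos) auto
    ultimately have "(\<sigma> * (q - 2) + \<alpha>) * Gamma (\<alpha> - 1)
             / ((q - 1) * \<mu> powr (q - 2) * (\<sigma> * (q - 2) + \<alpha> + 1)
                * Beta (\<alpha> - 1) (\<sigma> * (q - 2) + 1))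
           * inverse (integral {0..1} a) \<le> 0"
      using a_int_pos q c \<alpha> by (intro mult_nonpos_nonneg divide_nonneg_nonpos mult_nonneg_nonpos) auto
    with k_less k_pos show False by simp
  qed
qed

text \<open>
  The two summands come from the kernels \<open>(1 - s)\<^sup>\<alpha>\<^sup>-\<^sup>1 / \<Gamma>(\<alpha>)\<close> and \<open>(1 - s)\<^sup>\<alpha>\<^sup>-\<^sup>2 / \<Gamma>(\<alpha> - 1)\<close>
  whose sum dominates the Green's function.
\<close>

definition L :: real where
  "L = (q - 1) * \<mu> powr (q - 2) * k * integral {0..1} a *
     (Beta \<alpha> (\<sigma> * (q - 2) + 1) / Gamma \<alpha> + Beta (\<alpha> - 1) (\<sigma> * (q - 2) + 1) / Gamma (\<alpha> - 1))"

text \<open>\<open>Beta_Suc_ratio\<close> turns \<open>L\<close> into \<open>k\<close> divided by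
  the upper bound in \<open>k_less\<close>.\<close>

lemma L: "0 \<le> L" "L < 1"
proof -
  define \<beta> where "\<beta> = \<sigma> * (q - 2) + 1"
  have b: "\<beta> > 0" using exponent_gt by (simp add: \<beta>_def)
  have G: "Gamma (\<alpha> - 1) > 0" "Gamma \<alpha> > 0" "Beta (\<alpha> - 1) \<beta> > 0" "Beta \<alpha> \<beta> > 0"
    using \<alpha> b by (auto simp: Beta_def intro!: Gamma_real_pos divide_pos_pos mult_pos_pos)
  show "0 \<le> L" unfolding L_def using G k_pos q a_int_pos
    by (auto simp flip: \<beta>_def intro!: mult_nonneg_nonneg add_nonneg_nonneg divide_nonneg_nonneg)
  define N where "N = (q - 1) * \<mu> powr (q - 2) * ((\<alpha> + \<beta>) * Beta (\<alpha> - 1) \<beta>) * integral {0..1} a"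
  have N: "N > 0" unfolding N_def using q \<mu> \<alpha> b G a_int_pos by (intro mult_pos_pos) auto
  have "k < (\<alpha> - 1 + \<beta>) * Gamma (\<alpha> - 1) / N"
  proof -
    have "\<sigma> * (q - 2) + \<alpha> = \<alpha> - 1 + \<beta>" by (simp add: \<beta>_def)
    from k_less[unfolded this, folded \<beta>_def] show ?thesis
      by (simp add: N_def divide_inverse mult_ac)
  qed
  then have "k * N < (\<alpha> - 1 + \<beta>) * Gamma (\<alpha> - 1)"
    using N by (simp add: field_simps)
  moreover have "(\<alpha> - 1 + \<beta>) * Gamma (\<alpha> - 1) > 0" using G \<alpha> b by simp
  moreover have "L = k * N / ((\<alpha> - 1 + \<beta>) * Gamma (\<alpha> - 1))"
    unfolding L_def N_def \<beta>_def [symmetric] using Beta_Suc_ratio[of \<alpha> \<beta>] \<alpha> b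
    by (simp add: ac_simps)
  ultimately show "L < 1" by simp
qed

section \<open>Estimates for the integrated source and its power\<close>

lemma source_cont:
  assumes "admissible u"
  shows "continuous_on {0..1} (\<lambda>s. a s * f s (u s))"
proof -
  have "continuous_on {0..1} (\<lambda>s. (\<lambda>(t, u). f t u) (s, u s))"
    by (rule continuous_on_compose2[OF f_cont])
       (use assms in \<open>auto simp: admissible_def intro!: continuous_intros\<close>)
  then show ?thesis by (intro continuous_on_mult a_cont) auto
qed

lemma source_nonneg: "admissible u \<Longrightarrow> t \<in> {0..1} \<Longrightarrow> a t * f t (u t) \<ge> 0"
  using a_nonneg f_nonneg by (auto simp: admissible_def)

lemma F_deriv:
  assumes "admissible u" "t \<in> {0..1}"
  shows "(F u has_vector_derivative a t * f t (u t)) (at t within {0..1})"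
  unfolding F_def using integral_has_vector_derivative[OF source_cont[OF assms(1)] assms(2)] by simp

lemma F_cont: "admissible u \<Longrightarrow> continuous_on {0..1} (F u)"
  unfolding continuous_on_eq_continuous_within
  using has_vector_derivative_continuous[OF F_deriv] by blast

text \<open>Integrating the lower bound on the source gives exactly
  \<open>\<mu> * t powr \<sigma>\<close>.\<close>

lemma F_lower:
  assumes u: "admissible u" and t: "t \<in> {0..1}"
  shows "\<mu> * t powr \<sigma> \<le> F u t"
proof -
  have i: "((\<lambda>s. \<mu> * \<sigma> * s powr (\<sigma> - 1)) has_integral \<mu> * \<sigma> * (t powr (\<sigma> - 1 + 1) / (\<sigma> - 1 + 1))) {0..t}"
    using \<sigma> t by (intro has_integral_mult_right has_integral_powr_from_0) auto
  have "\<mu> * \<sigma> * (t powr (\<sigma> - 1 + 1) / (\<sigma> - 1 + 1)) \<le> F u t"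
  proof (rule has_integral_le[OF i])
    show "((\<lambda>s. a s * f s (u s)) has_integral F u t) {0..t}"
      unfolding F_def using t continuous_on_subset[OF source_cont[OF u], of "{0..t}"]
      by (intro integrable_integral integrable_continuous_real) auto
    show "\<mu> * \<sigma> * s powr (\<sigma> - 1) \<le> a s * f s (u s)" if "s \<in> {0..t}" for s
    proof (cases "s = 0")
      \<comment> \<open>The lower bound is assumed for positive times only; at 0 the power is 0 by
        convention and nonnegativity of the source suffices.\<close>
      case True
      then show ?thesis using source_nonneg[OF u, of 0] by simp
    next
      case False
      then show ?thesis using af_lower that t u by (auto simp: admissible_def)
    qed
  qed
  then show ?thesis using \<sigma> by simp
qed

lemma F_nonneg: "admissible u \<Longrightarrow> t \<in> {0..1} \<Longrightarrow> F u t \<ge> 0"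
  using F_lower[of u t] \<mu> by (smt (verit) mult_nonneg_nonneg powr_ge_zero)

lemma F_pos: "admissible u \<Longrightarrow> t \<in> {0<..1} \<Longrightarrow> F u t > 0"
  using F_lower[of u t] \<mu> by (smt (verit) mult_pos_pos powr_gt_zero atLeastAtMost_iff greaterThanAtMost_iff)

lemma F_powr_bound:
  assumes "admissible u" "t \<in> {0<..1}"
  shows "F u t powr (q - 2) \<le> \<mu> powr (q - 2) * t powr (\<sigma> * (q - 2))"
proof -
  have "F u t powr (q - 2) \<le> (\<mu> * t powr \<sigma>) powr (q - 2)"
    using assms F_lower[of u t] \<mu> q by (intro powr_mono2') auto
  then show ?thesis using \<mu> by (simp add: powr_mult powr_powr)
qed

lemma H_nonneg: "H u t \<ge> 0"
  by (simp add: H_def)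

lemma H_cont: "admissible u \<Longrightarrow> continuous_on {0..1} (H u)"
  unfolding H_def using F_nonneg q by (intro continuous_on_powr' F_cont continuous_on_const) auto

lemma H_integrable: "admissible u \<Longrightarrow> set_integrable lborel {0<..<1} (H u)"
  by (intro set_integrable_unit_interval H_cont)

lemma H_deriv:
  assumes u: "admissible u" and t: "t \<in> {0<..<1}"
  shows "(H u has_vector_derivative H' u t) (at t)"
proof -
  have "(F u has_real_derivative a t * f t (u t)) (at t within {0..1})"
    using F_deriv[OF u, of t] t by (simp add: has_real_derivative_iff_has_vector_derivative)
  moreover have "at t within {0..1} = at t"
    using t by (intro at_within_interior) auto
  ultimately have "(F u has_real_derivative a t * f t (u t)) (at t)" by simp
  then have "((\<lambda>t. F u t powr (q - 1)) has_real_derivative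
      (q - 1) * F u t powr (q - 1 - of_nat 1) * (a t * f t (u t))) (at t)"
    by (rule DERIV_fun_powr) (use F_pos[OF u, of t] t in auto)
  then show ?thesis
    by (simp add: H_def[abs_def] H'_def has_real_derivative_iff_has_vector_derivative)
qed

lemma H'_cont:
  assumes u: "admissible u"
  shows "continuous_on {0<..1} (H' u)"
proof -
  have "continuous_on {0<..1} (F u)" "continuous_on {0<..1} (\<lambda>t. a t * f t (u t))"
    by (rule continuous_on_subset[OF F_cont[OF u]] continuous_on_subset[OF source_cont[OF u]]; auto)+
  moreover have "\<forall>t\<in>{0<..1}. F u t \<noteq> 0" using F_pos[OF u] by force
  ultimately show ?thesis unfolding H'_def
    by (intro continuous_on_mult[where f = "\<lambda>t. (q - 1) * F u t powr (q - 2)"] continuous_on_mult_left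
        continuous_on_powr continuous_on_const) auto
qed

text \<open>The source is bounded by compactness, so only the negative power of \<open>F u\<close>
  matters. The resulting majorant is integrable by \<open>exponent_gt\<close>.\<close>

lemma H'_bound:
  assumes u: "admissible u"
  obtains C where "\<And>t. t \<in> {0<..1} \<Longrightarrow> \<bar>H' u t\<bar> \<le> C * t powr (\<sigma> * (q - 2))"
proof -
  have "bounded ((\<lambda>s. a s * f s (u s)) ` {0..1})"
    using source_cont[OF u] by (intro compact_imp_bounded compact_continuous_image) auto
  then obtain M where "M > 0" "\<forall>y\<in>(\<lambda>s. a s * f s (u s)) ` {0..1}. norm y \<le> M"
    unfolding bounded_pos by blast
  then have M: "\<And>s. s \<in> {0..1} \<Longrightarrow> \<bar>a s * f s (u s)\<bar> \<le> M" "M > 0"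
    by auto
  show ?thesis
  proof (rule that)
    fix t :: real assume t: "t \<in> {0<..1}"
    have "\<bar>H' u t\<bar> = (q - 1) * F u t powr (q - 2) * \<bar>a t * f t (u t)\<bar>"
      using q by (simp add: H'_def abs_mult)
    also have "\<dots> \<le> (q - 1) * (\<mu> powr (q - 2) * t powr (\<sigma> * (q - 2))) * M"
      using F_powr_bound[OF u t] M t q by (intro mult_mono) auto
    finally show "\<bar>H' u t\<bar> \<le> ((q - 1) * \<mu> powr (q - 2) * M) * t powr (\<sigma> * (q - 2))"
      by (simp add: mult_ac)
  qed
qed

lemma powr_integrable: "set_integrable lborel {0<..<1} (\<lambda>s. C * s powr (\<sigma> * (q - 2)))"
proof -
  have "set_integrable lborel {0<..<1} (\<lambda>s::real. (1 - s) powr (1 - 1) * s powr (\<sigma> * (q - 2)))"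
    using exponent_gt by (intro rl_integral_powr(1)) auto
  also have "?this \<longleftrightarrow> set_integrable lborel {0<..<1} (\<lambda>s. s powr (\<sigma> * (q - 2)))"
    by (rule set_integrable_cong) auto
  finally show ?thesis by (rule set_integrable_mult_right)
qed

lemma H'_integrable:
  assumes u: "admissible u"
  shows "set_integrable lborel {0<..<1} (H' u)"
proof -
  obtain C where C: "\<And>t. t \<in> {0<..1} \<Longrightarrow> \<bar>H' u t\<bar> \<le> C * t powr (\<sigma> * (q - 2))"
    using H'_bound[OF u] by metis
  show ?thesis
    by (rule set_integrable_dominated[OF powr_integrable[of C] set_borel_measurable_unit[OF H'_cont[OF u]]])
       (use C in auto)
qed

text \<open>No boundary term survives, because \<open>F u 0 = 0\<close> and
  \<open>0 powr (q - 1) = 0\<close>.\<close>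

lemma H_eq:
  assumes u: "admissible u" and t: "t \<in> {0..1}"
  shows "rl_integral 1 (H' u) t = H u t"
proof -
  have "rl_integral 1 (H' u) t = H u t - H u 0"
    by (rule rl_integral_1_FTC) (use u t H_cont H_deriv H'_integrable in auto)
  then show ?thesis by (simp add: H_def F_def)
qed

lemma F_diff:
  assumes u: "admissible u" and v: "admissible v" and t: "t \<in> {0..1}"
    and \<delta>: "\<And>s. s \<in> {0..1} \<Longrightarrow> \<bar>u s - v s\<bar> \<le> \<delta>"
  shows "\<bar>F u t - F v t\<bar> \<le> k * \<delta> * integral {0..1} a"
proof -
  have sub: "{0..t} \<subseteq> {0..1}" using t by auto
  note i = integrable_continuous_real[OF continuous_on_subset[OF _ sub]]
  have \<delta>0: "\<delta> \<ge> 0" using \<delta>[of 0] by auto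
  have "F u t - F v t = integral {0..t} (\<lambda>s. a s * f s (u s) - a s * f s (v s))"
    unfolding F_def using u v by (intro integral_diff[symmetric] i source_cont)
  also have "norm \<dots> \<le> integral {0..t} (\<lambda>s. k * \<delta> * a s)"
  proof (rule integral_norm_bound_integral)
    show "(\<lambda>s. a s * f s (u s) - a s * f s (v s)) integrable_on {0..t}"
      using u v by (intro i continuous_intros source_cont)
    show "(\<lambda>s. k * \<delta> * a s) integrable_on {0..t}"
      by (intro i continuous_intros a_cont)
    fix s assume "s \<in> {0..t}"
    then have s: "s \<in> {0..1}" using sub by auto
    have "\<bar>f s (u s) - f s (v s)\<bar> \<le> k * \<bar>u s - v s\<bar>"
      using f_lip s u v by (auto simp: admissible_def)
    also have "\<dots> \<le> k * \<delta>" using \<delta>[OF s] k_pos by simp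
    finally have "\<bar>a s\<bar> * \<bar>f s (u s) - f s (v s)\<bar> \<le> a s * (k * \<delta>)"
      using a_nonneg s by (intro mult_mono) auto
    then show "norm (a s * f s (u s) - a s * f s (v s)) \<le> k * \<delta> * a s"
      by (simp flip: abs_mult right_diff_distrib add: mult_ac)
  qed
  also have "\<dots> = k * \<delta> * integral {0..t} a" by simp
  also have "\<dots> \<le> k * \<delta> * integral {0..1} a"
    using k_pos \<delta>0 a_nonneg sub
    by (intro mult_left_mono integral_subset_le i integrable_continuous_real a_cont) auto
  finally show ?thesis by simp
qed

text \<open>The mean value estimate is used with \<open>\<mu> * t powr \<sigma>\<close>, a common
  lower bound for \<open>F u t\<close> and \<open>F v t\<close>.\<close>

lemma H_diff:
  assumes u: "admissible u" and v: "admissible v" and t: "t \<in> {0<..<1}"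
    and \<delta>: "\<And>s. s \<in> {0..1} \<Longrightarrow> \<bar>u s - v s\<bar> \<le> \<delta>"
  shows "\<bar>H u t - H v t\<bar> \<le> (q - 1) * \<mu> powr (q - 2) * k * integral {0..1} a * \<delta> * t powr (\<sigma> * (q - 2))"
proof -
  have "\<bar>H u t - H v t\<bar> \<le> (q - 1) * (\<mu> * t powr \<sigma>) powr (q - 1 - 1) * \<bar>F u t - F v t\<bar>"
    unfolding H_def by (rule powr_diff_bound) (use q \<mu> t F_lower[OF u, of t] F_lower[OF v, of t] in auto)
  also have "(\<mu> * t powr \<sigma>) powr (q - 1 - 1) = \<mu> powr (q - 2) * t powr (\<sigma> * (q - 2))"
    using \<mu> by (simp add: powr_mult powr_powr)
  also have "(q - 1) * (\<mu> powr (q - 2) * t powr (\<sigma> * (q - 2))) * \<bar>F u t - F v t\<bar> \<le>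
      (q - 1) * (\<mu> powr (q - 2) * t powr (\<sigma> * (q - 2))) * (k * \<delta> * integral {0..1} a)"
    using F_diff[OF u v _ \<delta>, of t] t q by (intro mult_left_mono) auto
  finally show ?thesis by (simp add: mult_ac)
qed

text \<open>Each of the two differences in \<open>solution_op\<close> is bounded by the integral of
  the weight \<open>m\<close> at 1, so \<open>t\<close> and \<open>\<eta>\<close> drop out; the two
  Beta values make up \<open>L\<close>.\<close>

lemma solution_op_contraction:
  assumes u: "admissible u" and v: "admissible v" and t: "t \<in> {0..1}"
    and \<delta>: "\<And>s. s \<in> {0..1} \<Longrightarrow> \<bar>u s - v s\<bar> \<le> \<delta>"
  shows "\<bar>solution_op u t - solution_op v t\<bar> \<le> L * \<delta>"
proof -
  define d where "d = (\<lambda>s. H u s + - H v s)"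
  define M where "M = (q - 1) * \<mu> powr (q - 2) * k * integral {0..1} a * \<delta>"
  define m where "m = (\<lambda>s. M * s powr (\<sigma> * (q - 2)))"
  have neg: "set_integrable lborel {0<..<1} (\<lambda>s. - H v s)"
    by (intro set_integrable_unit_interval continuous_intros H_cont v)
  have d: "set_integrable lborel {0<..<1} d"
    unfolding d_def by (intro set_integral_add H_integrable u neg)
  have m: "set_integrable lborel {0<..<1} m"
    unfolding m_def by (rule powr_integrable)
  have dm: "\<bar>d s\<bar> \<le> m s" if "s \<in> {0<..<1}" for s
    using H_diff[OF u v that \<delta>] by (simp add: d_def m_def M_def)
  have rd: "rl_integral b d s = rl_integral b (H u) s - rl_integral b (H v) s"
    if "b \<ge> 1" "s \<in> {0..1}" for b s
    unfolding d_def using rl_integral_add[OF H_integrable[OF u] neg that] by (simp add: rl_integral_minus)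
  have rm: "rl_integral b m 1 = M * (Beta b (\<sigma> * (q - 2) + 1) / Gamma b)" if "b > 0" for b
    using rl_integral_powr(2)[OF that exponent_gt, of 1]
    by (simp add: m_def rl_integral_cmult)
  have "solution_op u t - solution_op v t = (rl_integral \<alpha> d 1 - rl_integral \<alpha> d t) +
      (rl_integral (\<alpha> - 1) d 1 - rl_integral (\<alpha> - 1) d \<eta>)"
    using \<alpha> t \<eta> by (simp add: solution_op_def rd)
  also have "\<bar>\<dots>\<bar> \<le> rl_integral \<alpha> m 1 + rl_integral (\<alpha> - 1) m 1"
    using rl_integral_diff_bound[OF d m _ t dm, of \<alpha>]
      rl_integral_diff_bound[OF d m _ _ dm, of "\<alpha> - 1" \<eta>] \<alpha> \<eta> by auto
  also have "\<dots> = L * \<delta>"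
    using \<alpha> by (simp add: rm L_def M_def distrib_left mult_ac)
  finally show ?thesis .
qed

section \<open>Existence and uniqueness of the fixed point\<close>

lemma solution_op_admissible:
  assumes u: "admissible u"
  shows "admissible (solution_op u)"
  unfolding admissible_def
proof
  have "continuous_on {0..1} (rl_integral (1 + (\<alpha> - 1)) (H u))"
    using \<alpha> by (intro rl_integral_1_plus(3) H_integrable u) auto
  then show "continuous_on {0..1} (solution_op u)"
    unfolding solution_op_def by (intro continuous_intros) auto
  show "\<forall>t\<in>{0..1}. solution_op u t \<ge> 0"
  proof
    fix t :: real assume "t \<in> {0..1}"
    then have "rl_integral \<alpha> (H u) t \<le> rl_integral \<alpha> (H u) 1"
      using \<alpha> by (intro rl_integral_mono_endpoint H_integrable u H_nonneg) auto
    moreover have "rl_integral (\<alpha> - 1) (H u) \<eta> \<le> rl_integral (\<alpha> - 1) (H u) 1"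
      using \<alpha> \<eta> by (intro rl_integral_mono_endpoint H_integrable u H_nonneg) auto
    ultimately show "solution_op u t \<ge> 0" by (simp add: solution_op_def)
  qed
qed

text \<open>Banach's theorem is applied to the nonnegative bounded continuous functions on the whole
  line. As \<open>solution_op g\<close> is controlled on the unit interval only,
  \<open>clamp\<close> extends it by its end point values.\<close>

lemma solution_op_fixed_point: "\<exists>u. admissible u \<and> (\<forall>t\<in>{0..1}. u t = solution_op u t)"
proof -
  define S where "S = (PiC UNIV (\<lambda>_. {0..}) :: (real \<Rightarrow>\<^sub>C real) set)"
  have "\<exists>w. \<forall>x. apply_bcontfun w x = solution_op g (clamp 0 1 x)" if "g \<in> S" for g :: "real \<Rightarrow>\<^sub>C real"
  proof -
    have "admissible g" using that by (auto simp: S_def mem_PiC_iff admissible_def Pi_def)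
    then have "continuous_on (cbox 0 1) (solution_op g)" using solution_op_admissible by (auto simp: admissible_def)
    then show ?thesis by (rule continuous_on_cbox_bcontfunE) metis
  qed
  then obtain T where T: "\<And>g x. g \<in> S \<Longrightarrow> apply_bcontfun (T g) x = solution_op g (clamp 0 1 x)"
    by metis
  have adm: "admissible g" if "g \<in> S" for g :: "real \<Rightarrow>\<^sub>C real"
    using that by (auto simp: S_def mem_PiC_iff admissible_def Pi_def)
  have clamp: "clamp 0 1 x \<in> {0..1}" for x :: real
    using clamp_in_interval[of "0::real" 1 x] by simp
  have "\<exists>!g\<in>S. T g = g"
  proof (rule Banach_fix[OF _ _ L])
    show "complete S" unfolding S_def by (simp add: complete_eq_closed closed_PiC)
    have "const_bcontfun 0 \<in> S" by (simp add: S_def mem_PiC_iff const_bcontfun.rep_eq)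
    then show "S \<noteq> {}" by auto
    show "T ` S \<subseteq> S"
      using T solution_op_admissible[OF adm] clamp by (auto simp: S_def[symmetric] admissible_def) (auto simp: S_def mem_PiC_iff)
    fix g w assume gw: "g \<in> S" "w \<in> S"
    show "dist (T g) (T w) \<le> L * dist g w"
    proof (rule dist_bound)
      fix x
      show "dist (T g x) (T w x) \<le> L * dist g w"
        unfolding T[OF gw(1)] T[OF gw(2)] dist_real_def
        by (rule solution_op_contraction[OF adm[OF gw(1)] adm[OF gw(2)] clamp])
           (use dist_bounded[of g _ w] in \<open>simp add: dist_real_def\<close>)
    qed
  qed
  then obtain g where g: "g \<in> S" "T g = g" by auto
  have "g t = solution_op g t" if "t \<in> {0..1}" for t
    using T[OF g(1), of t] g(2) that clamp_cancel_cbox[of t 0 1] by simp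
  with adm[OF g(1)] show ?thesis by blast
qed

text \<open>The functions compared here need not be bounded or continuous off the unit interval, so
  the contraction is used directly, at a point where their distance is maximal.\<close>

lemma solution_op_fixed_point_unique:
  assumes u: "admissible u" "\<forall>t\<in>{0..1}. u t = solution_op u t"
    and v: "admissible v" "\<forall>t\<in>{0..1}. v t = solution_op v t" and t: "t \<in> {0..1}"
  shows "v t = u t"
proof -
  have "continuous_on {0..1} (\<lambda>t. \<bar>u t - v t\<bar>)"
    using u v by (intro continuous_intros) (auto simp: admissible_def)
  then obtain x where x: "x \<in> {0..1}" "\<And>t. t \<in> {0..1} \<Longrightarrow> \<bar>u t - v t\<bar> \<le> \<bar>u x - v x\<bar>"
    using continuous_attains_sup[of "{0..1::real}" "\<lambda>t. \<bar>u t - v t\<bar>"] by auto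
  have "\<bar>u x - v x\<bar> \<le> L * \<bar>u x - v x\<bar>"
    using solution_op_contraction[OF u(1) v(1) x(1) x(2)] u(2) v(2) x(1) by simp
  then have "u x = v x" using L by (cases "u x = v x") auto
  with x(2)[OF t] show ?thesis by simp
qed

end

section \<open>Solutions and fixed points\<close>

lemma nderiv_0 [simp]: "nderiv 0 g = g"
  by (simp add: nderiv_def)

lemma nderiv_Suc: "nderiv (Suc n) g t = vector_derivative (nderiv n g) (at t within {0..1})"
  by (simp add: nderiv_def)

lemma nderiv_SucI:
  assumes "\<And>s. s \<in> {0..1} \<Longrightarrow> nderiv n u s = g s" "t \<in> {0..1}"
    and "(g has_vector_derivative d) (at t within {0..1})"
  shows "nderiv n u differentiable (at t within {0..1})" "nderiv (Suc n) u t = d"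
proof -
  have "(nderiv n u has_vector_derivative d) (at t within {0..1})"
    by (rule has_vector_derivative_transform[OF assms(2,1,3)])
  then show "nderiv n u differentiable (at t within {0..1})" "nderiv (Suc n) u t = d"
    using vector_derivative_within_cbox[of 0 1 t "nderiv n u" d] assms(2)
    by (auto simp: nderiv_Suc intro: differentiableI_vector)
qed

lemma rl_integral_1_nderiv:
  assumes "continuous_on {0..1} (nderiv n u)"
    and "\<And>t. t \<in> {0<..<1} \<Longrightarrow> nderiv n u differentiable (at t within {0..1})"
    and "set_integrable lborel {0<..<1} (nderiv (Suc n) u)" "t \<in> {0..1}"
  shows "rl_integral 1 (nderiv (Suc n) u) t = nderiv n u t - nderiv n u 0"
proof (rule rl_integral_1_FTC[OF assms(1) _ assms(3,4)])
  fix x :: real assume x: "x \<in> {0<..<1}"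
  have "at x within {0..1} = at x" using x by (intro at_within_interior) auto
  with assms(2)[OF x] show "(nderiv n u has_vector_derivative nderiv (Suc n) u x) (at x)"
    by (simp add: vector_derivative_works nderiv_Suc)
qed

lemma C_diff_on_unit:
  assumes "C_diff_on n u {0..1}" "j \<le> n"
  shows "continuous_on {0..1} (nderiv j u)"
proof (cases "j = n")
  case True
  then show ?thesis using assms by (simp add: C_diff_on_def)
next
  case False
  then have "nderiv j u differentiable (at t within {0..1})" if "t \<in> {0..1}" for t
    using that assms unfolding C_diff_on_def by auto
  then show ?thesis
    unfolding continuous_on_eq_continuous_within using differentiable_imp_continuous_within by blast
qed

lemma floor_23:
  fixes \<alpha> :: real
  assumes "2 < \<alpha>" "\<alpha> \<le> 3"
  shows "\<alpha> \<in> \<int> \<Longrightarrow> \<alpha> = 3" "\<alpha> \<notin> \<int> \<Longrightarrow> \<alpha> < 3" "\<alpha> \<notin> \<int> \<Longrightarrow> nat \<lfloor>\<alpha>\<rfloor> = 2"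
proof -
  show "\<alpha> = 3" if "\<alpha> \<in> \<int>"
  proof -
    from that obtain n where "\<alpha> = of_int n" by (auto elim: Ints_cases)
    with assms show ?thesis by simp
  qed
  show lt: "\<alpha> < 3" if "\<alpha> \<notin> \<int>" using that assms by (cases "\<alpha> = 3") auto
  show "nat \<lfloor>\<alpha>\<rfloor> = 2" if "\<alpha> \<notin> \<int>"
    using lt[OF that] assms floor_eq[of 2 \<alpha>] by simp
qed

text \<open>Here \<open>n = 3\<close>, and the exponent \<open>- (\<alpha> + 1 - 3)\<close> equals
  \<open>(3 - \<alpha>) - 1\<close>. The two notions of integrability differ by end points and
  completion of the measure; continuity on \<open>{0<..1}\<close> supplies Borel
  measurability.\<close>

lemma caputo_as_rl_integral:
  fixes \<alpha> t :: real
  assumes \<alpha>: "2 < \<alpha>" "\<alpha> \<le> 3" "\<alpha> \<notin> \<int>" and t: "t \<in> {0..1}"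
    and cont: "continuous_on {0<..1} (nderiv 3 u)"
  shows "caputo_integrand \<alpha> u t absolutely_integrable_on {0..t} \<longleftrightarrow>
      set_integrable lborel {0<..<t} (\<lambda>s. (t - s) powr (3 - \<alpha> - 1) * nderiv 3 u s)"
    and "set_integrable lborel {0<..<t} (\<lambda>s. (t - s) powr (3 - \<alpha> - 1) * nderiv 3 u s) \<Longrightarrow>
      caputo \<alpha> u t = rl_integral (3 - \<alpha>) (nderiv 3 u) t"
proof -
  let ?g = "\<lambda>s. (t - s) powr (3 - \<alpha> - 1) * nderiv 3 u s"
  have fl: "nat \<lfloor>\<alpha>\<rfloor> + 1 = 3" using floor_23[OF \<alpha>(1,2)] \<alpha>(3) by simp
  have ci: "caputo_integrand \<alpha> u t = ?g"
  proof
    fix s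
    have "(t - s) powr (3 - \<alpha> - 1) = inverse ((t - s) powr (\<alpha> - 2))"
      by (simp flip: powr_minus)
    then show "caputo_integrand \<alpha> u t s = ?g s"
      unfolding caputo_integrand_def fl Let_def by (simp add: divide_inverse mult.commute)
  qed
  have "continuous_on {0<..<t} ?g"
    by (intro continuous_intros continuous_on_subset[OF cont]) (use t in auto)
  then have m: "(\<lambda>s. indicator {0<..<t} s *\<^sub>R ?g s) \<in> borel_measurable lborel"
    using borel_measurable_continuous_on_indicator[of "{0<..<t}" ?g] by simp
  have "caputo_integrand \<alpha> u t absolutely_integrable_on {0..t} \<longleftrightarrow> ?g absolutely_integrable_on {0<..<t}"
    unfolding ci
  proof (rule absolutely_integrable_spike_set_eq)
    show "negligible {x \<in> {0..t} - {0<..<t}. ?g x \<noteq> 0}"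
      by (rule negligible_subset[OF negligible_finite[of "{0, t}"]]) auto
    have "{x \<in> {0<..<t} - {0..t}. ?g x \<noteq> 0} = {}" by auto
    then show "negligible {x \<in> {0<..<t} - {0..t}. ?g x \<noteq> 0}" by (metis negligible_empty)
  qed
  also have "\<dots> \<longleftrightarrow> set_integrable lborel {0<..<t} ?g"
    unfolding set_integrable_def using m by (rule integrable_completion)
  finally show "caputo_integrand \<alpha> u t absolutely_integrable_on {0..t} \<longleftrightarrow> set_integrable lborel {0<..<t} ?g" .
  assume "set_integrable lborel {0<..<t} ?g"
  then have "(LINT s:{0<..<t}|lborel. ?g s) = integral {0..t} ?g"
    by (simp add: set_borel_integral_eq_integral(2) integral_open_interval_real)
  then show "caputo \<alpha> u t = rl_integral (3 - \<alpha>) (nderiv 3 u) t"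
    unfolding caputo_def Let_def fl ci rl_integral_def using \<alpha>(3) by simp
qed

lemma p_laplacian_cont: "p > 2 \<Longrightarrow> continuous_on S (p_laplacian p)"
  unfolding p_laplacian_def by (intro continuous_intros continuous_on_powr') auto

section \<open>Regularity of fixed points, and why they are solutions\<close>

context fractional_bvp
begin

text \<open>The \<open>p\<close>-Laplacian is odd, and \<open>(q - 1) * (p - 1) = 1\<close> makes
  the two powers inverse to each other.\<close>

lemma p_laplacian_powr: "y \<ge> 0 \<Longrightarrow> p_laplacian p (- (y powr (q - 1))) = - y"
proof (cases "y = 0")
  case False
  assume "y \<ge> 0"
  have "(y powr (q - 1)) powr (p - 2) * y powr (q - 1) = y powr ((q - 1) * (p - 1))"
    by (simp add: powr_powr algebra_simps flip: powr_add)
  then show ?thesis using pq' False \<open>y \<ge> 0\<close> by (simp add: p_laplacian_def)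
qed (simp add: p_laplacian_def)

lemma p_laplacian_eqD:
  assumes "y \<ge> 0" "p_laplacian p x = - y"
  shows "x = - (y powr (q - 1))"
proof (cases "x = 0")
  case True
  then show ?thesis using assms by (simp add: p_laplacian_def)
next
  case False
  have x: "x < 0"
  proof (rule ccontr)
    assume "\<not> x < 0"
    with False have "p_laplacian p x > 0" by (simp add: p_laplacian_def)
    with assms show False by simp
  qed
  have "y = (- x) powr (p - 2) * (- x) powr 1"
    using assms(2) x by (simp add: p_laplacian_def)
  also have "\<dots> = (- x) powr (p - 1)" by (subst powr_add [symmetric]) simp
  finally have "y powr (q - 1) = (- x) powr ((q - 1) * (p - 1))" by (simp add: powr_powr mult.commute)
  then show ?thesis using pq' x by simp
qed

text \<open>As \<open>H u\<close> is itself an integral of \<open>H' u\<close>, one order of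
  smoothness is gained; this gives continuity on the closed interval even for orders below
  one.\<close>

lemma rl_integral_H:
  assumes u: "admissible u" and b: "b > 0" and t: "t \<in> {0..1}"
  shows "rl_integral b (H u) t = rl_integral (1 + b) (H' u) t"
proof -
  have "rl_integral b (H u) t = rl_integral b (rl_integral 1 (H' u)) t"
    by (rule rl_integral_cong) (use H_eq[OF u] t in auto)
  also have "\<dots> = rl_integral (b + 1) (H' u) t"
    by (rule rl_integral_semigroup(2)) (use b kernel_integrable[OF H'_integrable[OF u], of "b + 1" t] t in auto)
  finally show ?thesis by (simp add: add.commute)
qed

lemma rl_integral_H_cont:
  assumes u: "admissible u" and b: "b > 0"
  shows "continuous_on {0..1} (rl_integral b (H u))"
  using rl_integral_1_plus(3)[OF H'_integrable[OF u] b]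
  by (rule continuous_on_eq) (rule rl_integral_H[OF u b, symmetric])

lemma rl_integral_H_deriv:
  assumes u: "admissible u" and b: "b > 1" and t: "t \<in> {0..1}"
  shows "(rl_integral b (H u) has_vector_derivative rl_integral (b - 1) (H u) t) (at t within {0..1})"
proof -
  have "continuous (at t within {0..1}) (rl_integral (b - 1) (H u))"
    using rl_integral_H_cont[OF u, of "b - 1"] b t by (simp add: continuous_on_eq_continuous_within)
  then show ?thesis
    using rl_integral_1_plus(4)[OF H_integrable[OF u] _ t, of "b - 1"] b by simp
qed

lemma rl_integral_H'_cont:
  assumes u: "admissible u" and b: "b > 0"
  shows "continuous_on {0<..1} (rl_integral b (H' u))"
proof -
  obtain C where "\<And>t. t \<in> {0<..1} \<Longrightarrow> \<bar>H' u t\<bar> \<le> C * t powr (\<sigma> * (q - 2))"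
    using H'_bound[OF u] by metis
  then show ?thesis by (rule continuous_on_rl_integral[OF b exponent_gt H'_cont[OF u]])
qed

text \<open>When \<open>b \<le> 1\<close> the order cannot be lowered to a positive one, so the
  derivative falls on \<open>H u\<close> instead, at the cost of excluding 0.\<close>

lemma rl_integral_H_deriv':
  assumes u: "admissible u" and b: "b > 0" and t: "t \<in> {0<..1}"
  shows "(rl_integral b (H u) has_vector_derivative rl_integral b (H' u) t) (at t within {0..1})"
proof (rule has_vector_derivative_transform)
  have "at t within {0<..1} = at t within {0..1}"
    by (rule at_within_nhd[of t "{0<..}"]) (use t in auto)
  then have "continuous (at t within {0..1}) (rl_integral b (H' u))"
    using rl_integral_H'_cont[OF u b] t by (metis continuous_on_eq_continuous_within)
  then show "(rl_integral (1 + b) (H' u) has_vector_derivative rl_integral b (H' u) t) (at t within {0..1})"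
    by (intro rl_integral_1_plus(4) H'_integrable u b) (use t in auto)
qed (use t rl_integral_H[OF u b] in auto)

text \<open>Two differentiations lower the order from \<open>\<alpha>\<close> to
  \<open>\<alpha> - 2\<close>. For \<open>\<alpha> = 3\<close> a third one gives
  \<open>- H u\<close> on the closed interval; otherwise it passes to \<open>H' u\<close> and holds
  on \<open>{0<..1}\<close>.\<close>

lemma fixed_point_imp_solution:
  assumes u: "admissible u" and fix_u: "\<forall>t\<in>{0..1}. u t = solution_op u t"
  shows "is_bvp_solution p \<alpha> \<eta> a f u"
proof -
  define c where "c = rl_integral \<alpha> (H u) 1 +
     (rl_integral (\<alpha> - 1) (H u) 1 - rl_integral (\<alpha> - 1) (H u) \<eta>)"
  have u_eq: "nderiv 0 u t = c - rl_integral \<alpha> (H u) t" if "t \<in> {0..1}" for t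
    using fix_u that by (simp add: solution_op_def c_def)
  have D0: "((\<lambda>t. c - rl_integral \<alpha> (H u) t) has_vector_derivative - rl_integral (\<alpha> - 1) (H u) t) (at t within {0..1})"
    if "t \<in> {0..1}" for t
    using rl_integral_H_deriv[OF u _ that, of \<alpha>] \<alpha> by (auto intro!: derivative_eq_intros)
  note d0 = nderiv_SucI[OF u_eq _ D0]
  have n1: "nderiv 1 u t = - rl_integral (\<alpha> - 1) (H u) t" if "t \<in> {0..1}" for t
    using d0(2)[OF _ that that] by simp
  have D1: "((\<lambda>t. - rl_integral (\<alpha> - 1) (H u) t) has_vector_derivative - rl_integral (\<alpha> - 2) (H u) t) (at t within {0..1})"
    if "t \<in> {0..1}" for t
    using rl_integral_H_deriv[OF u _ that, of "\<alpha> - 1"] \<alpha> by (auto intro!: derivative_eq_intros)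
  note d1 = nderiv_SucI[OF n1 _ D1]
  have n2: "nderiv 2 u t = - rl_integral (\<alpha> - 2) (H u) t" if "t \<in> {0..1}" for t
    using d1(2)[OF _ that that] by (simp add: numeral_2_eq_2)
  have c2: "continuous_on {0..1} (nderiv 2 u)"
    by (subst continuous_on_cong[OF refl n2]) (use \<alpha> in \<open>auto intro!: continuous_intros rl_integral_H_cont u\<close>)
  have diff01: "nderiv j u differentiable (at t within {0..1})" if "j < 2" "t \<in> {0..1}" for j t
    using that d0(1)[of t] d1(1)[of t] by (auto simp: less_2_cases_iff)
  have main: "caputo_differentiable \<alpha> u \<and> (\<forall>t\<in>{0..1}. caputo \<alpha> u t = - H u t)"
  proof (cases "\<alpha> \<in> \<int>")
    case True
    then have [simp]: "\<alpha> = 3" using floor_23 \<alpha> by blast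
    have D2: "((\<lambda>t. - rl_integral (\<alpha> - 2) (H u) t) has_vector_derivative - H u t) (at t within {0..1})"
      if "t \<in> {0..1}" for t
      using rl_integral_1_has_vector_derivative[OF H_integrable[OF u] that] H_cont[OF u] that
      by (auto intro!: derivative_eq_intros simp: continuous_on_eq_continuous_within)
    note d2 = nderiv_SucI[OF n2 _ D2]
    have n3: "nderiv 3 u t = - H u t" if "t \<in> {0..1}" for t
      using d2(2)[OF _ that that] by (simp add: numeral_3_eq_3 numeral_2_eq_2)
    have "continuous_on {0..1} (nderiv 3 u)"
      by (subst continuous_on_cong[OF refl n3]) (auto intro!: continuous_intros H_cont u)
    moreover have "nderiv j u differentiable (at t within {0..1})" if "j < 3" "t \<in> {0..1}" for j t
      using that diff01[of j t] d2(1)[of t] by (cases "j = 2") auto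
    ultimately show ?thesis
      using n3 by (simp add: caputo_differentiable_def C_diff_on_def caputo_def)
  next
    case False
    note fl = floor_23[OF \<alpha>]
    have D2: "((\<lambda>t. - rl_integral (\<alpha> - 2) (H u) t) has_vector_derivative - rl_integral (\<alpha> - 2) (H' u) t) (at t within {0..1})"
      if "t \<in> {0<..1}" for t
      using rl_integral_H_deriv'[OF u _ that, of "\<alpha> - 2"] \<alpha> by (auto intro!: derivative_eq_intros)
    note d2 = nderiv_SucI[OF n2 _ D2]
    have n3: "nderiv 3 u t = - rl_integral (\<alpha> - 2) (H' u) t" if "t \<in> {0<..1}" for t
      using d2(2)[OF _ _ that] that by (simp add: numeral_3_eq_3 numeral_2_eq_2)
    have c3: "continuous_on {0<..1} (nderiv 3 u)"
      by (subst continuous_on_cong[OF refl n3]) (use \<alpha> in \<open>auto intro!: continuous_intros rl_integral_H'_cont u\<close>)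
    have diff2: "nderiv j u differentiable (at t within {0..1})" if "j < 3" "t \<in> {0<..1}" for j t
      using that diff01[of j t] d2(1)[of t] by (cases "j = 2") auto
    \<comment> \<open>The exponent is 0, so the semigroup law only asks for \<open>H' u\<close> to
      be integrable.\<close>
    have K: "set_integrable lborel {0<..<t} (\<lambda>s. (t - s) powr (3 - \<alpha> + (\<alpha> - 2) - 1) * H' u s)"
      if "t \<in> {0..1}" for t
      using kernel_integrable[OF H'_integrable[OF u], of 1 t] that by simp
    have pos: "3 - \<alpha> > 0" "\<alpha> - 2 > 0" using fl False \<alpha> by auto
    have I: "set_integrable lborel {0<..<t} (\<lambda>s. (t - s) powr (3 - \<alpha> - 1) * nderiv 3 u s)"
      if t: "t \<in> {0..1}" for t
    proof -
      have "set_integrable lborel {0<..<t} (\<lambda>s. - ((t - s) powr (3 - \<alpha> - 1) * rl_integral (\<alpha> - 2) (H' u) s))"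
        using rl_integral_semigroup(1)[OF pos K[OF t]] by (simp add: set_integrable_def)
      also have "?this \<longleftrightarrow> ?thesis" by (rule set_integrable_cong) (use n3 t in auto)
      finally show ?thesis .
    qed
    have "caputo \<alpha> u t = - H u t" if t: "t \<in> {0..1}" for t
    proof -
      have "caputo \<alpha> u t = rl_integral (3 - \<alpha>) (nderiv 3 u) t"
        by (rule caputo_as_rl_integral(2)[OF \<alpha> False t c3 I[OF t]])
      also have "\<dots> = rl_integral (3 - \<alpha>) (\<lambda>s. - rl_integral (\<alpha> - 2) (H' u) s) t"
        by (rule rl_integral_cong) (use n3 t in auto)
      also have "\<dots> = - rl_integral 1 (H' u) t"
        using rl_integral_semigroup(2)[OF pos K[OF t]] by (simp add: rl_integral_minus)
      finally show ?thesis using H_eq[OF u t] by simp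
    qed
    moreover have "caputo_differentiable \<alpha> u"
      using False fl c2 c3 diff01 diff2 I caputo_as_rl_integral(1)[OF \<alpha> False _ c3]
      by (simp add: caputo_differentiable_def C_diff_on_def)
    ultimately show ?thesis by blast
  qed
  then have cap: "caputo \<alpha> u t = - H u t" if "t \<in> {0..1}" for t using that by blast
  have deriv: "((\<lambda>s. p_laplacian p (caputo \<alpha> u s)) has_real_derivative - (a t * f t (u t))) (at t)"
    if t: "t \<in> {0<..<1}" for t
  proof -
    have "at t within {0..1} = at t" using t by (intro at_within_interior) auto
    then have "(F u has_real_derivative a t * f t (u t)) (at t)"
      using F_deriv[OF u, of t] t by (simp add: has_real_derivative_iff_has_vector_derivative)
    then have "((\<lambda>s. - F u s) has_real_derivative - (a t * f t (u t))) (at t)"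
      by (rule DERIV_minus)
    then show ?thesis
    proof (rule has_field_derivative_transform_within_open)
      fix s :: real assume "s \<in> {0<..<1}"
      then show "- F u s = p_laplacian p (caputo \<alpha> u s)"
        using cap[of s] p_laplacian_powr[OF F_nonneg[OF u, of s]] by (simp add: H_def)
    qed (use t in auto)
  qed
  have "continuous_on {0..1} (caputo \<alpha> u)"
    by (subst continuous_on_cong[OF refl cap]) (auto intro!: continuous_intros H_cont u)
  moreover have "u 1 + nderiv 1 u 1 = nderiv 1 u \<eta>"
    using u_eq[of 1] n1[of 1] n1[of \<eta>] \<eta> by (simp add: c_def)
  moreover have "caputo \<alpha> u 0 = 0" "nderiv 1 u 0 = 0" "nderiv 2 u 0 = 0"
    using cap[of 0] n1[of 0] n2[of 0] by (auto simp: H_def F_def)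
  moreover have "(\<lambda>s. p_laplacian p (caputo \<alpha> u s)) differentiable (at t) \<and>
      deriv (\<lambda>s. p_laplacian p (caputo \<alpha> u s)) t + a t * f t (u t) = 0" if "t \<in> {0<..<1}" for t
    using deriv[OF that] DERIV_imp_deriv[OF deriv[OF that]] real_differentiable_def by auto
  ultimately show ?thesis
    using u main unfolding is_bvp_solution_def admissible_def by blast
qed

section \<open>From solutions back to fixed points\<close>

lemma solution_caputo:
  assumes v: "admissible v" and sol: "is_bvp_solution p \<alpha> \<eta> a f v" and t: "t \<in> {0..1}"
  shows "caputo \<alpha> v t = - H v t"
proof -
  let ?P = "\<lambda>s. p_laplacian p (caputo \<alpha> v s)"
  have "((\<lambda>s. - (a s * f s (v s))) has_integral ?P t - ?P 0) {0..t}"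
  proof (rule fundamental_theorem_of_calculus_interior)
    \<comment> \<open>Continuity up to the ends allows the fundamental theorem to use the equation
      at interior points only, and gives the initial value its force.\<close>
    have "continuous_on {0..1} (caputo \<alpha> v)" using sol by (simp add: is_bvp_solution_def)
    then have "continuous_on {0..t} (caputo \<alpha> v)" by (rule continuous_on_subset) (use t in auto)
    then show "continuous_on {0..t} ?P"
      by (rule continuous_on_compose2[OF p_laplacian_cont[OF p] _ subset_UNIV])
    fix s assume "s \<in> {0<..<t}"
    then have "s \<in> {0<..<1}" using t by auto
    then have "?P differentiable (at s)" "deriv ?P s = - (a s * f s (v s))"
      using sol unfolding is_bvp_solution_def by (auto simp: add_eq_0_iff)
    then show "(?P has_vector_derivative - (a s * f s (v s))) (at s)"
      by (metis DERIV_deriv_iff_real_differentiable has_real_derivative_iff_has_vector_derivative)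
  qed (use t in auto)
  then have "?P t - ?P 0 = - F v t"
    unfolding F_def by (metis integral_neg integral_unique)
  moreover have "?P 0 = 0" using sol by (simp add: is_bvp_solution_def p_laplacian_def)
  ultimately show ?thesis
    unfolding H_def by (intro p_laplacian_eqD F_nonneg v t) simp
qed

text \<open>For \<open>\<alpha> < 3\<close>, applying order \<open>\<alpha> - 2\<close> to the
  Caputo derivative, which is order \<open>3 - \<alpha>\<close> of the third derivative, leaves one
  plain integration. The condition on the second derivative at 0 removes the constant.\<close>

lemma solution_nderiv_2:
  assumes v: "admissible v" and sol: "is_bvp_solution p \<alpha> \<eta> a f v" and t: "t \<in> {0..1}"
  shows "nderiv 2 v t = - rl_integral (\<alpha> - 2) (H v) t"
proof -
  have v2: "nderiv 2 v 0 = 0" and cd: "caputo_differentiable \<alpha> v"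
    using sol by (auto simp: is_bvp_solution_def)
  have S: "Suc 2 = 3" by simp
  note cap = solution_caputo[OF v sol]
  note FTC = rl_integral_1_nderiv[of 2 v, unfolded S v2]
  show ?thesis
  proof (cases "\<alpha> \<in> \<int>")
    case True
    then have [simp]: "\<alpha> = 3" using floor_23 \<alpha> by blast
    have C: "C_diff_on 3 v {0..1}" using cd by (simp add: caputo_differentiable_def)
    have "nderiv 2 v t = rl_integral 1 (nderiv 3 v) t"
      using FTC[OF C_diff_on_unit[OF C] _ set_integrable_unit_interval[OF C_diff_on_unit[OF C]] t] C
      by (simp add: C_diff_on_def)
    also have "\<dots> = rl_integral 1 (\<lambda>s. - H v s) t"
      by (rule rl_integral_cong) (use cap t in \<open>auto simp: caputo_def\<close>)
    finally show ?thesis by (simp add: rl_integral_minus)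
  next
    case False
    note fl = floor_23[OF \<alpha>]
    have C: "C_diff_on 2 v {0..1}" "C_diff_on 3 v {0<..1}"
      and I: "\<And>t. t \<in> {0..1} \<Longrightarrow> caputo_integrand \<alpha> v t absolutely_integrable_on {0..t}"
      using cd False fl by (auto simp: caputo_differentiable_def)
    have c3: "continuous_on {0<..1} (nderiv 3 v)" using C by (simp add: C_diff_on_def)
    have K: "set_integrable lborel {0<..<s} (\<lambda>r. (s - r) powr (3 - \<alpha> - 1) * nderiv 3 v r)"
      if "s \<in> {0..1}" for s
      using I[OF that] caputo_as_rl_integral(1)[OF \<alpha> False that c3] by simp
    \<comment> \<open>At time 1 the Caputo kernel has negative exponent and base below 1, so it is
      at least 1 and the integrand dominates the third derivative.\<close>
    have int: "set_integrable lborel {0<..<1} (nderiv 3 v)"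
    proof (rule set_integrable_dominated)
      show "set_integrable lborel {0<..<1} (\<lambda>s. \<bar>(1 - s) powr (3 - \<alpha> - 1) * nderiv 3 v s\<bar>)"
        using K[of 1] by (intro set_integrable_abs) auto
      show "set_borel_measurable lborel {0<..<1} (nderiv 3 v)"
        by (rule set_borel_measurable_unit[OF c3])
      fix s :: real assume s: "s \<in> {0<..<1}"
      have "1 powr (3 - \<alpha> - 1) \<le> (1 - s) powr (3 - \<alpha> - 1)"
        using s \<alpha> by (intro powr_mono2') auto
      then have "1 * \<bar>nderiv 3 v s\<bar> \<le> (1 - s) powr (3 - \<alpha> - 1) * \<bar>nderiv 3 v s\<bar>"
        by (intro mult_right_mono) auto
      then show "\<bar>nderiv 3 v s\<bar> \<le> \<bar>(1 - s) powr (3 - \<alpha> - 1) * nderiv 3 v s\<bar>"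
        by (simp add: abs_mult)
    qed
    have "nderiv 2 v t = rl_integral 1 (nderiv 3 v) t"
      using FTC[OF C_diff_on_unit[OF C(1)] _ int t] C(2) by (simp add: C_diff_on_def)
    also have "\<dots> = rl_integral (\<alpha> - 2) (rl_integral (3 - \<alpha>) (nderiv 3 v)) t"
    proof -
      have "set_integrable lborel {0<..<t} (\<lambda>s. (t - s) powr (\<alpha> - 2 + (3 - \<alpha>) - 1) * nderiv 3 v s)"
        using kernel_integrable[OF int _ t, of 1] by simp
      then have "rl_integral (\<alpha> - 2) (rl_integral (3 - \<alpha>) (nderiv 3 v)) t =
          rl_integral (\<alpha> - 2 + (3 - \<alpha>)) (nderiv 3 v) t"
        using fl(2)[OF False] \<alpha> by (intro rl_integral_semigroup(2)) auto
      then show ?thesis by simp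
    qed
    also have "\<dots> = rl_integral (\<alpha> - 2) (\<lambda>s. - H v s) t"
      by (rule rl_integral_cong)
         (use t cap caputo_as_rl_integral(2)[OF \<alpha> False _ c3 K] in \<open>force simp: \<alpha>\<close>)
    finally show ?thesis by (simp add: rl_integral_minus)
  qed
qed

lemma solution_imp_fixed_point:
  assumes sol: "is_bvp_solution p \<alpha> \<eta> a f v"
  shows "admissible v" "\<forall>t\<in>{0..1}. v t = solution_op v t"
proof -
  have C: "C_diff_on 2 v {0..1}"
  proof (cases "\<alpha> \<in> \<int>")
    case True
    then have "C_diff_on 3 v {0..1}"
      using sol floor_23[OF \<alpha>] by (simp add: is_bvp_solution_def caputo_differentiable_def)
    then show ?thesis using C_diff_on_unit[of 3 v 2] by (simp add: C_diff_on_def)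
  next
    case False
    then show ?thesis
      using sol floor_23[OF \<alpha>] by (simp add: is_bvp_solution_def caputo_differentiable_def)
  qed
  note cont = C_diff_on_unit[OF C]
  have diff: "nderiv j v differentiable (at t within {0..1})" if "j < 2" "t \<in> {0<..<1}" for j t
    using C that by (auto simp: C_diff_on_def)
  show v: "admissible v"
    using cont[of 0] sol by (simp add: admissible_def is_bvp_solution_def)
  have BC: "nderiv 1 v 0 = 0" "v 1 + nderiv 1 v 1 = nderiv 1 v \<eta>"
    using sol by (auto simp: is_bvp_solution_def)
  have n1: "nderiv 1 v t = - rl_integral (\<alpha> - 1) (H v) t" if t: "t \<in> {0..1}" for t
  proof -
    have "nderiv 1 v t = rl_integral 1 (nderiv 2 v) t"
      using rl_integral_1_nderiv[OF cont[of 1] diff, of t] set_integrable_unit_interval[OF cont[of 2]] t BC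
      by (simp add: numeral_2_eq_2)
    also have "\<dots> = rl_integral 1 (\<lambda>s. - rl_integral (\<alpha> - 2) (H v) s) t"
      by (rule rl_integral_cong) (use solution_nderiv_2[OF v sol] t in auto)
    also have "\<dots> = - rl_integral (\<alpha> - 1) (H v) t"
      using rl_integral_1_plus(2)[OF H_integrable[OF v] _ t, of "\<alpha> - 2"] \<alpha> by (simp add: rl_integral_minus)
    finally show ?thesis .
  qed
  have n0: "v t = v 0 - rl_integral \<alpha> (H v) t" if t: "t \<in> {0..1}" for t
  proof -
    have "v t - v 0 = rl_integral 1 (nderiv 1 v) t"
      using rl_integral_1_nderiv[OF cont[of 0] diff, of t] set_integrable_unit_interval[OF cont[of 1]] t
      by simp
    also have "\<dots> = rl_integral 1 (\<lambda>s. - rl_integral (\<alpha> - 1) (H v) s) t"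
      by (rule rl_integral_cong) (use n1 t in auto)
    also have "\<dots> = - rl_integral \<alpha> (H v) t"
      using rl_integral_1_plus(2)[OF H_integrable[OF v] _ t, of "\<alpha> - 1"] \<alpha> by (simp add: rl_integral_minus)
    finally show ?thesis by simp
  qed
  show "\<forall>t\<in>{0..1}. v t = solution_op v t"
  proof
    fix t :: real assume t: "t \<in> {0..1}"
    \<comment> \<open>At 1 and \<open>\<eta>\<close> the two formulas turn the boundary condition
      into a linear equation for \<open>v 0\<close>.\<close>
    have "(1 :: real) \<in> {0..1}" "\<eta> \<in> {0..1}" using \<eta> by auto
    from n0[OF t] n0[OF this(1)] n1[OF this(1)] n1[OF this(2)] BC(2)
    show "v t = solution_op v t" unfolding solution_op_def by linarith
  qed
qed

text \<open>Solutions are compared on \<open>{0..1}\<close> because the problem leaves their values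
  elsewhere free.\<close>

lemma unique_solution:
  "\<exists>u. is_bvp_solution p \<alpha> \<eta> a f u \<and>
     (\<forall>v. is_bvp_solution p \<alpha> \<eta> a f v \<longrightarrow> (\<forall>t\<in>{0..1}. v t = u t))"
proof -
  obtain u where u: "admissible u" "\<forall>t\<in>{0..1}. u t = solution_op u t"
    using solution_op_fixed_point by blast
  have "v t = u t" if "is_bvp_solution p \<alpha> \<eta> a f v" "t \<in> {0..1}" for v t
    using solution_op_fixed_point_unique[OF u solution_imp_fixed_point[OF that(1)] that(2)] .
  with fixed_point_imp_solution[OF u] show ?thesis by blast
qed

end

theorem theorem3p5:
  fixes p q \<alpha> \<eta> \<mu> \<sigma> k :: real
    and f :: "real \<Rightarrow> real \<Rightarrow> real"
    and a :: "real \<Rightarrow> real"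
  assumes "p > 2" and "1 / p + 1 / q = 1"
    and "2 < \<alpha>" and "\<alpha> \<le> 3"
    and "0 < \<eta>" and "\<eta> < 1"
    and "continuous_on ({0..1} \<times> {0..}) (\<lambda>(t, u). f t u)"
    and "\<forall>t\<in>{0..1}. \<forall>u\<ge>0. f t u \<ge> 0"
    and "\<exists>t\<in>{0..1}. f t 0 \<noteq> 0"
    and "continuous_on {0..1} a"
    and "\<forall>t\<in>{0..1}. a t \<ge> 0"
    and "\<forall>c d. 0 \<le> c \<and> c < d \<and> d \<le> 1 \<longrightarrow> (\<exists>t\<in>{c..d}. a t \<noteq> 0)"
    and "\<mu> > 0" and "0 < \<sigma>" and "\<sigma> < 2 / (2 - q)"
    and "\<forall>t\<in>{0<..1}. \<forall>u\<ge>0. a t * f t u \<ge> \<mu> * \<sigma> * t powr (\<sigma> - 1)"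
    and "\<forall>t\<in>{0..1}. \<forall>u\<ge>0. \<forall>v\<ge>0. \<bar>f t u - f t v\<bar> \<le> k * \<bar>u - v\<bar>"
    and "0 < k"
    and "k < (\<sigma> * (q - 2) + \<alpha>) * Gamma (\<alpha> - 1)
             / ((q - 1) * \<mu> powr (q - 2) * (\<sigma> * (q - 2) + \<alpha> + 1)
                * Beta (\<alpha> - 1) (\<sigma> * (q - 2) + 1))
           * inverse (integral {0..1} a)"
  shows "\<exists>u. is_bvp_solution p \<alpha> \<eta> a f u \<and>
           (\<forall>v. is_bvp_solution p \<alpha> \<eta> a f v \<longrightarrow> (\<forall>t\<in>{0..1}. v t = u t))"
proof -
  interpret fractional_bvp p q \<alpha> \<eta> \<mu> \<sigma> k f a
  proof
    show "\<exists>t\<in>{0..1}. a t \<noteq> 0" using assms(12)[rule_format, of 0 1] by simp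
  qed (use assms in auto)
  show ?thesis by (rule unique_solution)
qed

end
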